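(* There exists a constant $C>0$ (depending only on $\phi$ and $d$) such that $$p^{\phi}(n,x,y)\le C\left(\big(\phi^{-1}(n^{-1})\big)^{d/2}\wedge\frac{n}{|x-y|^d}\,\phi(|x-y|^{-2})\right)$$ for all $x,y\in\mathbb{Z}^d$ and all $n\in\mathbb{N}=\{1,2,\dots\}$.
   Context: Let $d\ge 1$ and let $(S_n)_{n\ge0}$ be the simple symmetric random walk on $\mathbb{Z}^d$ (each step is uniform on $\{\pm e_1,\dots,\pm e_d\}$). Let $\phi$ be a complete Bernstein function without drift, normalized by $\phi(0)=0$, $\phi(1)=1$; i.e. $\phi(\lambda)=\int_{(0,\infty)}(1-e^{-\lambda t})\,\mu(dt)$, where $\mu$ is a measure with $\int_{(0,\infty)}(1\wedge t)\,\mu(dt)<\infty$ having a completely monotone density with respect to Lebesgue measure. Assume the scaling condition: there are constants $c_*,c^*>0$ and $0<\alpha_*\le\alpha^*<1$ with $$c_*\Big(\frac Rr\Big)^{\alpha_*}\le\frac{\phi(R)}{\phi(r)}\le c^*\Big(\frac Rr\Big)^{\alpha^*},\qquad 0<r\le R\le1 .$$ The function $\phi$ is strictly increasing and $\phi^{-1}$ denotes its inverse (well defined on $(0,1]$). Put $a_m^\phi=\frac1{m!}\int_{(0,\infty)}t^me^{-t}\,\mu(dt)$, $m\ge1$; then $\sum_{m\ge1}a_m^\phi=1$. Let $R_1,R_2,\dots$ be i.i.d., independent of $(S_n)$, with $\mathbb{P}(R_1=m)=a_m^\phi$, and $\tau_n=R_1+\cdots+R_n$. The subordinate random walk is $S^\phi_n=S_{\tau_n}$,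 $n\ge0$. $\mathbb{P}^x$ is the law of the walk started at $x$ and $p^\phi(n,x,y)=\mathbb{P}^x(S^\phi_n=y)$. Notation: $a\wedge b=\min\{a,b\}$, $|\cdot|$ is the Euclidean norm; for $x=y$ the expression $\frac{n}{|x-y|^d}\phi(|x-y|^{-2})$ is interpreted as $+\infty$. *)

theory Defs
  imports "HOL-Probability.Probability"
begin

subsection \<open>Complete Bernstein functions\<close>

definition completely_monotone :: "(real \<Rightarrow> real) \<Rightarrow> bool" where
  "completely_monotone f \<longleftrightarrow>
     (\<forall>n. \<forall>t>0. (deriv ^^ n) f differentiable (at t) \<and> 0 \<le> (-1) ^ n * (deriv ^^ n) f t)"

text \<open>
  \<open>\<phi>\<close> has no drift and no killing term, and its Levy measure \<open>\<mu>\<close>, a measure on \<open>(0,\<infinity>)\<close>, is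
  represented by a Borel measure on the real line that does not charge \<open>(-\<infinity>,0]\<close>.
  The values of \<open>\<phi>\<close> at negative arguments are irrelevant.
\<close>

definition complete_bernstein :: "(real \<Rightarrow> real) \<Rightarrow> real measure \<Rightarrow> bool" where
  "complete_bernstein \<phi> \<mu> \<longleftrightarrow>
     (\<exists>f. completely_monotone f \<and>
          \<mu> = density lborel (\<lambda>t. ennreal (f t) * indicator {0<..} t)) \<and>
     (\<integral>\<^sup>+t\<in>{0<..}. ennreal (min 1 t) \<partial>\<mu>) < \<infinity> \<and>
     (\<forall>l\<ge>0. \<phi> l = (LINT t:{0<..}|\<mu>. 1 - exp (- l * t)))"

definition scaling_condition :: "(real \<Rightarrow> real) \<Rightarrow> bool" where
  "scaling_condition \<phi> \<longleftrightarrow>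
     (\<exists>c1 c2 \<alpha>1 \<alpha>2. 0 < c1 \<and> 0 < c2 \<and> 0 < \<alpha>1 \<and> \<alpha>1 \<le> \<alpha>2 \<and> \<alpha>2 < 1 \<and>
       (\<forall>r R. 0 < r \<and> r \<le> R \<and> R \<le> 1 \<longrightarrow>
          c1 * (R / r) powr \<alpha>1 \<le> \<phi> R / \<phi> r \<and> \<phi> R / \<phi> r \<le> c2 * (R / r) powr \<alpha>2))"

subsection \<open>The subordinate random walk\<close>

definition jump_weight :: "real measure \<Rightarrow> nat \<Rightarrow> real" where
  "jump_weight \<mu> m = 1 / fact m * (LINT t:{0<..}|\<mu>. t ^ m * exp (- t))"

definition jump_pmf :: "real measure \<Rightarrow> nat pmf" where
  "jump_pmf \<mu> = embed_pmf (\<lambda>m. if m = 0 then 0 else jump_weight \<mu> m)"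

definition unit_steps :: "(int ^ 'd) set" where
  "unit_steps = range (\<lambda>i. axis i 1) \<union> range (\<lambda>i. - axis i 1)"

text \<open>
  Canonical probability space of the construction: a sample point is a pair consisting of the
  i.i.d. steps of the simple random walk and of the i.i.d. increments of the random time,
  the two sequences being independent of each other.
\<close>

definition walk_space :: "real measure \<Rightarrow> ((nat \<Rightarrow> int ^ 'd) \<times> (nat \<Rightarrow> nat)) measure" where
  "walk_space \<mu> = (\<Pi>\<^sub>M k\<in>UNIV. measure_pmf (pmf_of_set unit_steps)) \<Otimes>\<^sub>M
                  (\<Pi>\<^sub>M k\<in>UNIV. measure_pmf (jump_pmf \<mu>))"

definition simple_walk :: "int ^ 'd \<Rightarrow> (nat \<Rightarrow> int ^ 'd) \<Rightarrow> nat \<Rightarrow> int ^ 'd" where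
  "simple_walk x \<xi> n = x + (\<Sum>k<n. \<xi> k)"

definition random_time :: "(nat \<Rightarrow> nat) \<Rightarrow> nat \<Rightarrow> nat" where
  "random_time \<rho> n = (\<Sum>k<n. \<rho> k)"

definition subordinate_walk ::
  "int ^ 'd \<Rightarrow> (nat \<Rightarrow> int ^ 'd) \<times> (nat \<Rightarrow> nat) \<Rightarrow> nat \<Rightarrow> int ^ 'd" where
  "subordinate_walk x \<omega> n = simple_walk x (fst \<omega>) (random_time (snd \<omega>) n)"

definition transition_prob :: "real measure \<Rightarrow> nat \<Rightarrow> int ^ 'd \<Rightarrow> int ^ 'd \<Rightarrow> real" where
  "transition_prob \<mu> n x y =
     measure (walk_space \<mu>) {\<omega> \<in> space (walk_space \<mu>). subordinate_walk x \<omega> n = y}"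

definition lattice_norm :: "int ^ 'd \<Rightarrow> real" where
  "lattice_norm x = norm ((\<chi> i. real_of_int (x $ i)) :: real ^ 'd)"

definition off_diagonal_bound :: "(real \<Rightarrow> real) \<Rightarrow> nat \<Rightarrow> int ^ 'd \<Rightarrow> int ^ 'd \<Rightarrow> ereal" where
  "off_diagonal_bound \<phi> n x y =
     (if x = y then \<infinity>
      else ereal (real n / lattice_norm (x - y) ^ CARD('d) * \<phi> (lattice_norm (x - y) powi (-2))))"

subsection \<open>The laws above are the intended ones\<close>

lemma finite_unit_steps: "finite (unit_steps :: (int ^ 'd::finite) set)"
  and unit_steps_nonempty: "(unit_steps :: (int ^ 'd::finite) set) \<noteq> {}"
  by (auto simp: unit_steps_def)

lemma poisson_weight_sums:
  fixes t :: real
  shows "(\<lambda>m. if m = 0 then 0 else t ^ m * exp (- t) / fact m) sums (1 - exp (- t))"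
proof -
  have "(\<lambda>m. t ^ m / fact m) sums exp t"
    using exp_converges[of t] by (simp add: divide_inverse mult.commute)
  hence "(\<lambda>m. t ^ m / fact m * exp (- t)) sums (exp t * exp (- t))"
    by (rule sums_mult2)
  hence "(\<lambda>m. t ^ m * exp (- t) / fact m) sums 1"
    by (simp add: exp_minus)
  moreover have "(\<lambda>m. if m = 0 then exp (- t) else 0) sums exp (- t)"
    using sums_single[of 0 "\<lambda>_. exp (- t)"] by simp
  ultimately have "(\<lambda>m. t ^ m * exp (- t) / fact m - (if m = 0 then exp (- t) else 0)) sums (1 - exp (- t))"
    by (rule sums_diff)
  moreover have "(\<lambda>m. t ^ m * exp (- t) / fact m - (if m = 0 then exp (- t) else 0)) =
     (\<lambda>m. if m = 0 then 0 else t ^ m * exp (- t) / fact m)"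
    by auto
  ultimately show ?thesis by simp
qed

lemma pmf_jump_pmf:
  assumes \<phi>: "complete_bernstein \<phi> \<mu>" and one: "\<phi> 1 = 1"
  shows "pmf (jump_pmf \<mu>) m = (if m = 0 then 0 else jump_weight \<mu> m)"
proof -
  let ?g = "\<lambda>m t::real. indicator {0<..} t * (if m = 0 then 0 else t ^ m * exp (- t) / fact m)"
  have sets [measurable_cong]: "sets \<mu> = sets borel"
    using \<phi> by (auto simp: complete_bernstein_def)
  have fin: "(\<integral>\<^sup>+t\<in>{0<..}. ennreal (min 1 t) \<partial>\<mu>) < \<infinity>"
    and rep: "\<phi> 1 = (LINT t:{0<..}|\<mu>. 1 - exp (- t))"
    using \<phi> by (auto simp: complete_bernstein_def)
  have nn: "0 \<le> ?g m t" for m t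
    by (auto simp: indicator_def)
  have sums: "(\<lambda>m. ?g m t) sums (indicator {0<..} t * (1 - exp (- t)))" for t
    by (rule sums_mult[OF poisson_weight_sums])
  have le: "?g m t \<le> indicator {0<..} t * (1 - exp (- t))" for m t
    using sum_le_suminf[OF sums_summable[OF sums], of "{m}" t] nn sums_unique[OF sums[of t]]
    by (simp only: finite.intros sum.insert sum.empty empty_iff if_False simp_thms ball_simps
        insert_iff subset_UNIV add_0_right)
  have int1: "integrable \<mu> (\<lambda>t. indicator {0<..} t * (1 - exp (- t)))"
  proof (rule integrableI_bounded)
    have "(\<integral>\<^sup>+t. ennreal (norm (indicator {0<..} t * (1 - exp (- t)))) \<partial>\<mu>) \<le>
          (\<integral>\<^sup>+t\<in>{0<..}. ennreal (min 1 t) \<partial>\<mu>)"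
    proof (rule nn_integral_mono)
      fix t :: real
      show "ennreal (norm (indicator {0<..} t * (1 - exp (- t)))) \<le> ennreal (min 1 t) * indicator {0<..} t"
        using exp_ge_add_one_self[of "-t"] by (auto simp: indicator_def intro!: ennreal_leI)
    qed
    thus "(\<integral>\<^sup>+t. ennreal (norm (indicator {0<..} t * (1 - exp (- t)))) \<partial>\<mu>) < \<infinity>"
      using fin by (rule le_less_trans)
  qed measurable
  have intg: "integrable \<mu> (?g m)" for m
  proof (rule Bochner_Integration.integrable_bound[OF int1])
    show "AE t in \<mu>. norm (?g m t) \<le> norm (indicator {0<..} t * (1 - exp (- t)) :: real)"
      using nn le by (intro AE_I2) (smt (verit) real_norm_def)
  qed measurable
  have w: "(if m = 0 then 0 else jump_weight \<mu> m) = (LINT t|\<mu>. ?g m t)" for m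
    by (simp add: jump_weight_def set_lebesgue_integral_def flip: integral_mult_right_zero)
  have "(\<integral>\<^sup>+m. ennreal (if m = 0 then 0 else jump_weight \<mu> m) \<partial>count_space UNIV) =
        (\<Sum>m. \<integral>\<^sup>+t. ennreal (?g m t) \<partial>\<mu>)"
    unfolding nn_integral_count_space_nat w
    by (simp only: nn_integral_eq_integral[OF intg AE_I2[OF nn]])
  also have "\<dots> = (\<integral>\<^sup>+t. (\<Sum>m. ennreal (?g m t)) \<partial>\<mu>)"
    by (rule nn_integral_suminf[symmetric]) measurable
  also have "\<dots> = (\<integral>\<^sup>+t. ennreal (indicator {0<..} t * (1 - exp (- t))) \<partial>\<mu>)"
  proof (rule nn_integral_cong)
    fix t :: real
    show "(\<Sum>m. ennreal (?g m t)) = ennreal (indicator {0<..} t * (1 - exp (- t)))"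
      by (rule suminf_ennreal_eq[OF nn sums])
  qed
  also have "\<dots> = ennreal (LINT t|\<mu>. indicator {0<..} t * (1 - exp (- t)))"
    by (rule nn_integral_eq_integral[OF int1]) (auto simp: indicator_def)
  also have "\<dots> = 1"
    using rep one by (simp add: set_lebesgue_integral_def)
  finally have total: "(\<integral>\<^sup>+m. ennreal (if m = 0 then 0 else jump_weight \<mu> m) \<partial>count_space UNIV) = 1" .
  have nonneg: "0 \<le> (if m = 0 then 0 else jump_weight \<mu> m)" for m
    unfolding w by (rule integral_nonneg_AE) (use nn in auto)
  show ?thesis
    unfolding jump_pmf_def by (rule pmf_embed_pmf[OF nonneg total])
qed

lemma prob_space_walk_space: "prob_space (walk_space \<mu>)"
  unfolding walk_space_def
  by (intro prob_space_pair prob_space_PiM measure_pmf.prob_space_axioms)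

lemma subordinate_walk_measurable:
  "(\<lambda>\<omega>. subordinate_walk x \<omega> n) \<in>
     measurable (walk_space \<mu>) (count_space (UNIV :: (int ^ 'd::finite) set))"
proof -
  have plus: "(\<lambda>\<omega>. f \<omega> + g \<omega>) \<in> measurable M (count_space UNIV)"
    if f: "f \<in> measurable M (count_space UNIV)" and g: "g \<in> measurable M (count_space UNIV)"
    for f g :: "'x \<Rightarrow> 'y :: {countable, comm_monoid_add}" and M
  proof (rule measurable_compose_countable[OF _ f, of "\<lambda>i \<omega>. i + g \<omega>"])
    show "(\<lambda>\<omega>. i + g \<omega>) \<in> measurable M (count_space UNIV)" for i
      by (rule measurable_compose[OF g]) simp
  qed
  have sum: "(\<lambda>\<omega>. \<Sum>k<m. f k \<omega>) \<in> measurable M (count_space UNIV)"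
    if f: "\<And>k. f k \<in> measurable M (count_space UNIV)"
    for f :: "nat \<Rightarrow> 'x \<Rightarrow> 'y :: {countable, comm_monoid_add}" and M and m :: nat
    by (induction m) (auto intro: plus f)
  have step: "(\<lambda>\<omega>. fst \<omega> k) \<in>
      measurable (walk_space \<mu>) (count_space (UNIV :: (int ^ 'd) set))" for k
  proof -
    have "(\<lambda>\<xi>. \<xi> k) \<in> measurable (\<Pi>\<^sub>M k\<in>(UNIV :: nat set).
        measure_pmf (pmf_of_set (unit_steps :: (int ^ 'd) set))) (count_space UNIV)"
      using measurable_component_singleton[of k UNIV "\<lambda>_. measure_pmf (pmf_of_set unit_steps)"]
      by (simp cong: measurable_cong_sets)
    thus ?thesis
      unfolding walk_space_def by (rule measurable_compose[OF measurable_fst])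
  qed
  have jump: "(\<lambda>\<omega>. snd \<omega> k) \<in>
      measurable (walk_space \<mu> :: ((nat \<Rightarrow> int ^ 'd) \<times> _) measure) (count_space UNIV)" for k
  proof -
    have "(\<lambda>\<rho>. \<rho> k) \<in> measurable (\<Pi>\<^sub>M k\<in>(UNIV :: nat set).
        measure_pmf (jump_pmf \<mu>)) (count_space UNIV)"
      using measurable_component_singleton[of k UNIV "\<lambda>_. measure_pmf (jump_pmf \<mu>)"]
      by (simp cong: measurable_cong_sets)
    thus ?thesis
      unfolding walk_space_def by (rule measurable_compose[OF measurable_snd])
  qed
  show ?thesis
    unfolding subordinate_walk_def simple_walk_def random_time_def
    by (rule measurable_compose_countable[OF _ sum[OF jump]])
       (intro plus sum step measurable_const, simp)
qed

end

theory Submission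
  imports Defs
begin

text \<open>
  The subordinate walk is the simple random walk at an independent random time \<open>\<tau>\<^sub>n\<close>, so its
  transition probability is the expectation of \<open>p(\<tau>\<^sub>n, y - x)\<close>, where \<open>p(m, z)\<close> is the probability
  that the simple random walk moves by \<open>z\<close> in \<open>m\<close> steps (\<open>transition_prob_mixture\<close>). Both halves of
  the estimate follow by inserting a bound on \<open>p(m, z)\<close> and integrating it against the law of \<open>\<tau>\<^sub>n\<close>,
  about which only the generating function is used: the expectation of \<open>s\<close> to the power \<open>\<tau>\<^sub>n\<close> is
  \<open>(1 - \<phi> (1 - s))\<close> to the power \<open>n\<close> (\<open>time_generating_function\<close>).

  Off the diagonal, the Gaussian bound for \<open>p(m, z)\<close> implies that \<open>p(m, z)\<close> is at most a constant times
  \<open>|z|\<^sup>-\<^sup>d min(1, m / |z|\<^sup>2)\<close>, both for times shorter and for times longer than the diffusive time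
  \<open>|z|\<^sup>2\<close> (\<open>lattice_walk_local_bounds\<close>). The expectation of \<open>min(1, \<tau>\<^sub>n / R)\<close> is comparable with that
  of \<open>1 - exp (- \<tau>\<^sub>n / R)\<close>, which is at most \<open>n \<phi>(1 / R)\<close> by Bernoulli's inequality
  (\<open>time_truncated_mean\<close>). With \<open>R = |z|\<^sup>2\<close> this is the second term of the minimum.

  On the diagonal, \<open>p(m, z)\<close> is at most a constant times \<open>m\<close> to the power \<open>- d / 2\<close>, so the negative
  moment of \<open>\<tau>\<^sub>n\<close> of order \<open>d / 2\<close> is needed. By the lower scaling bound the probability that \<open>\<tau>\<^sub>n\<close> is
  a small fraction of \<open>1 / \<phi>\<^sup>-\<^sup>1(1 / n)\<close> decays faster than every power of that fraction, so the moment
  is of the order given by the typical size of \<open>\<tau>\<^sub>n\<close> (\<open>time_negative_moment\<close>).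

  The Gaussian bound for the simple random walk in dimension \<open>d\<close> is reduced to dimension one: given
  the numbers \<open>N\<^sub>i\<close> of steps in the coordinate directions, the coordinates are independent walks on
  the line (\<open>lattice_walk_factor\<close>). The one-dimensional bound comes from the explicit quotient of
  neighbouring probabilities (\<open>line_walk_gauss\<close>), and the prefactors \<open>(N\<^sub>i + 1)\<close> to the power \<open>- 1 / 2\<close>
  are averaged by a size-bias identity for multinomial counts (\<open>multinomial_mean_prod_sqrt\<close>).
\<close>

section \<open>The simple random walk on the line\<close>

text \<open>
  The transition probabilities of the walk on \<open>\<int>\<close>, given by their recursion. The argument below rests on
  one identity between neighbouring values, so binomial coefficients never appear and the parity
  of \<open>n + z\<close> takes care of itself.
\<close>

primrec line_walk :: "nat \<Rightarrow> int \<Rightarrow> real" where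
  "line_walk 0 z = of_bool (z = 0)"
| "line_walk (Suc n) z = (line_walk n (z - 1) + line_walk n (z + 1)) / 2"

lemma line_walk_nonneg: "0 \<le> line_walk n z"
  by (induction n arbitrary: z) auto

lemma line_walk_uminus: "line_walk n (- z) = line_walk n z"
proof (induction n arbitrary: z)
  case (Suc n)
  show ?case
    using Suc[of "z + 1"] Suc[of "z - 1"]
    by (simp add: minus_diff_commute add.commute[of 1])
qed auto

lemma line_walk_eq_0: "int n < z \<Longrightarrow> line_walk n z = 0"
  by (induction n arbitrary: z) auto

text \<open>
  The quotient of consecutive binomial coefficients, multiplied out so that it also holds where
  the probabilities vanish.
\<close>

lemma line_walk_ratio:
  "(n + z + 2) * line_walk n (z + 2) = (n - z) * line_walk n z"
proof (induction n arbitrary: z)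
  case 0
  show ?case by (cases "z = -2") (auto simp: of_bool_def)
next
  case (Suc n)
  have "(n + z + 3) * line_walk n (z + 3) = (n - z - 1) * line_walk n (z + 1)"
    using Suc[of "z + 1"] by (simp add: algebra_simps)
  moreover have "(n + z + 1) * line_walk n (z + 1) = (n - z + 1) * line_walk n (z - 1)"
    using Suc[of "z - 1"] by (simp add: algebra_simps)
  moreover have "z + 2 - 1 = z + 1" "z + 2 + 1 = z + 3" by auto
  ultimately show ?case by (simp add: field_simps)
qed

lemma line_walk_Suc_1: "line_walk (Suc n) 1 = line_walk (Suc (Suc n)) 0"
  using line_walk_uminus[of "Suc n" 1] by (simp del: line_walk.simps(2) add: line_walk.simps(2)[of "Suc n"])

text \<open>
  Two steps multiply the return probability by \<open>(n + 1) / (n + 2)\<close>, which is at most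
  \<open>sqrt ((n + 1) / (n + 3))\<close> by the inequality of arithmetic and geometric means.
\<close>

lemma line_walk_return: "line_walk n 0 \<le> 1 / sqrt (real n + 1)"
proof (induction n rule: induct_nat_012)
  case (ge2 n)
  have "line_walk n 2 = n / (real n + 2) * line_walk n 0"
    using line_walk_ratio[of n 0] by (simp add: field_simps)
  hence "line_walk (Suc (Suc n)) 0 = (real n + 1) / (real n + 2) * line_walk n 0"
    unfolding line_walk_Suc_1[symmetric] by (simp add: field_simps)
  also have "\<dots> \<le> (real n + 1) / (real n + 2) * (1 / sqrt (real n + 1))"
    by (intro mult_left_mono ge2.IH) auto
  also have "\<dots> \<le> 1 / sqrt (real n + 3)"
  proof -
    have "sqrt (real n + 1) * sqrt (real n + 3) = sqrt ((real n + 1) * (real n + 3))"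
      by (simp only: real_sqrt_mult of_nat_mult)
    also have "\<dots> \<le> sqrt ((real n + 2)\<^sup>2)"
      by (intro real_sqrt_le_mono) (simp add: power2_eq_square algebra_simps)
    finally have "sqrt (real n + 1) * sqrt (real n + 3) \<le> real n + 2" by simp
    hence "sqrt (real n + 1) / (real n + 2) \<le> 1 / sqrt (real n + 3)"
      by (simp add: field_simps)
    moreover have "(real n + 1) / (real n + 2) * (1 / sqrt (real n + 1)) = sqrt (real n + 1) / (real n + 2)"
      using real_div_sqrt[of "real n + 1"]
      by (metis (no_types) mult.right_neutral of_nat_0_le_iff add_nonneg_nonneg zero_le_one
          times_divide_eq_right times_divide_eq_left)
    ultimately show ?thesis by simp
  qed
  finally show ?case by (simp add: add.commute)
qed auto

lemma line_walk_near_origin: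
  assumes "z = 0 \<or> z = 1" shows "line_walk n z \<le> 1 / sqrt (real n + 1)"
proof (cases "z = 0")
  case False
  show ?thesis
  proof (cases n)
    case (Suc k)
    have "line_walk n 1 \<le> 1 / sqrt (real (Suc n) + 1)"
      using line_walk_return[of "Suc n"] unfolding Suc line_walk_Suc_1 .
    also have "\<dots> \<le> 1 / sqrt (real n + 1)" by (simp add: frac_le)
    finally show ?thesis using assms False by simp
  qed (use assms False in auto)
qed (use line_walk_return in simp)

text \<open>
  The ratio identity gives the factor \<open>1 - 2 (z + 1) / (n + z + 2)\<close>, and \<open>z \<le> n\<close> on the support. The
  resulting exponential is exactly the quotient of the values of \<open>exp (- z\<^sup>2 / (4 (n + 1)))\<close> at
  \<open>z + 2\<close> and at \<open>z\<close>; this is where the constant 4 in the Gaussian bound comes from.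
\<close>

lemma line_walk_decay:
  assumes "0 \<le> z"
  shows "line_walk n (z + 2) \<le> exp (- (real_of_int z + 1) / (real n + 1)) * line_walk n z"
proof (cases "z \<le> int n")
  case True
  have "line_walk n (z + 2) = (n - z) / (n + z + 2) * line_walk n z"
    using line_walk_ratio[of n z] assms by (simp add: field_simps)
  moreover have "(n - z) / (n + z + 2) \<le> exp (- (real_of_int z + 1) / (real n + 1))"
  proof -
    have "(n - z) / (n + z + 2) = 1 - 2 * (z + 1) / (n + z + 2)"
      using assms by (simp add: field_simps)
    also have "\<dots> \<le> 1 - 2 * (z + 1) / (2 * (real n + 1))"
      using assms True by (intro diff_left_mono divide_left_mono) auto
    also have "\<dots> \<le> exp (- (real_of_int z + 1) / (real n + 1))"
      using exp_ge_add_one_self[of "- (real_of_int z + 1) / (real n + 1)"] by (simp add: field_simps)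
    finally show ?thesis .
  qed
  ultimately show ?thesis
    by (metis mult_right_mono line_walk_nonneg)
next
  case False
  thus ?thesis using line_walk_eq_0[of n "z + 2"] line_walk_nonneg[of n z] by simp
qed

text \<open>
  By the preceding lemma the walk divided by the Gaussian decreases along \<open>z0, z0 + 2, z0 + 4, \<dots>\<close>,
  so it is controlled by its value at the starting point.
\<close>

lemma line_walk_gauss_aux:
  assumes "z0 = 0 \<or> z0 = 1"
  shows "line_walk n (z0 + 2 * int k) * exp ((z0 + 2 * int k)\<^sup>2 / (4 * (real n + 1)))
           \<le> exp (z0\<^sup>2 / (4 * (real n + 1))) / sqrt (real n + 1)"
proof (induction k)
  case 0
  show ?case using line_walk_near_origin[OF assms, of n]
    by (simp add: field_simps)
next
  case (Suc k)
  let ?z = "z0 + 2 * int k"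
  have nn: "0 \<le> ?z" using assms by auto
  have "line_walk n (?z + 2) * exp ((?z + 2)\<^sup>2 / (4 * (real n + 1)))
     \<le> exp (- (real_of_int ?z + 1) / (real n + 1)) * line_walk n ?z * exp ((?z + 2)\<^sup>2 / (4 * (real n + 1)))"
    using line_walk_decay[OF nn, of n] by (rule mult_right_mono) simp
  also have "\<dots> = line_walk n ?z * exp (- (real_of_int ?z + 1) / (real n + 1) + (?z + 2)\<^sup>2 / (4 * (real n + 1)))"
    by (simp add: exp_add)
  also have "- (real_of_int ?z + 1) / (real n + 1) + (?z + 2)\<^sup>2 / (4 * (real n + 1)) = ?z\<^sup>2 / (4 * (real n + 1))"
  proof -
    have "- (x + 1) / t + (x + 2)\<^sup>2 / (4 * t) = x\<^sup>2 / (4 * t)" if "t > 0" for x t :: real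
      using that by (simp add: divide_simps) (simp add: power2_eq_square algebra_simps)
    from this[of "real n + 1" "real_of_int ?z"] show ?thesis
      by (simp del: of_int_mult of_int_add add: of_int_add[of ?z])
  qed
  finally show ?case using Suc by (simp add: algebra_simps)
qed

lemma line_walk_gauss:
  "line_walk n z \<le> 2 / sqrt (real n + 1) * exp (- (real_of_int z)\<^sup>2 / (4 * (real n + 1)))"
proof -
  have *: "line_walk n z \<le> 2 / sqrt (real n + 1) * exp (- (real_of_int z)\<^sup>2 / (4 * (real n + 1)))" if "0 \<le> z" for z
  proof -
    have z: "z = z mod 2 + 2 * int (nat (z div 2))" using that by simp
    have m: "z mod 2 = 0 \<or> z mod 2 = 1" by auto
    have "line_walk n z * exp (z\<^sup>2 / (4 * (real n + 1))) \<le> exp ((z mod 2)\<^sup>2 / (4 * (real n + 1))) / sqrt (real n + 1)"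
      using line_walk_gauss_aux[OF m, of n "nat (z div 2)"]
      unfolding z[symmetric] of_int_add[symmetric] of_int_mult[symmetric]
      using that by (simp add: algebra_simps)
    also have "\<dots> \<le> 2 / sqrt (real n + 1)"
    proof (rule divide_right_mono)
      have "exp ((z mod 2)\<^sup>2 / (4 * (real n + 1))) \<le> exp (1 / 2 :: real)"
        using m by (auto simp: field_simps)
      also have "\<dots> \<le> 2" using exp_bound_half[of "1/2 :: real"] by simp
      finally show "exp ((z mod 2)\<^sup>2 / (4 * (real n + 1))) \<le> 2" .
    qed simp
    finally show ?thesis by (simp add: exp_minus field_simps)
  qed
  show ?thesis using *[of z] *[of "- z"] line_walk_uminus[of n z] by (cases "0 \<le> z") auto
qed

section \<open>Averages over multinomial counts\<close>

text \<open>
  The expectation of \<open>f N\<close> where \<open>N i\<close> counts how often \<open>i\<close> occurs among \<open>m\<close> independent uniform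
  choices from \<open>'d\<close>, computed by conditioning on one choice at a time. It stands for the numbers
  of steps that the lattice walk makes in each coordinate direction.
\<close>

primrec multinomial_mean :: "nat \<Rightarrow> (('d::finite \<Rightarrow> nat) \<Rightarrow> real) \<Rightarrow> real" where
  "multinomial_mean 0 f = f (\<lambda>_. 0)"
| "multinomial_mean (Suc m) f =
     (\<Sum>i\<in>UNIV. multinomial_mean m (\<lambda>N. f (N(i := Suc (N i))))) / CARD('d)"

lemma multinomial_mean_add:
  "multinomial_mean m (\<lambda>N. f N + g N) = multinomial_mean m f + multinomial_mean m g"
  by (induction m arbitrary: f g) (simp_all add: sum.distrib add_divide_distrib)

lemma multinomial_mean_cmult:
  "multinomial_mean m (\<lambda>N. c * f N) = c * multinomial_mean m f"
  by (induction m arbitrary: f) (simp_all add: sum_distrib_left)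

lemma multinomial_mean_const: "multinomial_mean m (\<lambda>N :: 'd::finite \<Rightarrow> nat. c) = c"
  by (induction m) simp_all

text \<open>
  The comparison is only required at counts that can occur: no count exceeds \<open>m\<close>.
\<close>

lemma multinomial_mean_mono:
  assumes "\<And>N. (\<And>i. N i \<le> m) \<Longrightarrow> f N \<le> g N"
  shows "multinomial_mean m f \<le> multinomial_mean m g"
  using assms
proof (induction m arbitrary: f g)
  case (Suc m)
  show ?case
    unfolding multinomial_mean.simps
    by (intro divide_right_mono sum_mono Suc.IH Suc.prems) (auto simp: le_SucI)
qed auto

text \<open>
  By exchangeability, weighting with \<open>N j\<close> amounts to forcing one of the \<open>m + 1\<close> choices to be \<open>j\<close>,
  which has probability \<open>1 / CARD('d)\<close> for each of them.
\<close>

lemma multinomial_mean_size_bias: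
  fixes f :: "('d::finite \<Rightarrow> nat) \<Rightarrow> real"
  shows "multinomial_mean (Suc m) (\<lambda>N. N j * f N) =
    (real m + 1) / CARD('d) * multinomial_mean m (\<lambda>N. f (N(j := Suc (N j))))"
proof (induction m arbitrary: f)
  case 0
  have "(\<Sum>i\<in>UNIV. real (((\<lambda>_. 0)(i := Suc 0)) j) * f ((\<lambda>_. 0)(i := Suc 0))) =
        (\<Sum>i\<in>UNIV. if i = j then f ((\<lambda>_. 0)(j := Suc 0)) else 0)"
    by (intro sum.cong) auto
  thus ?case by (simp add: fun_upd_def)
next
  case (Suc m)
  let ?up = "\<lambda>i N :: 'd \<Rightarrow> nat. N(i := Suc (N i))"
  have comm: "?up j (?up i N) = ?up i (?up j N)" for i N
    by (cases "i = j") (auto simp: fun_upd_twist)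
  have split: "real (?up i N j) * f (?up i N) = N j * f (?up i N) + of_bool (i = j) * f (?up j N)" for i N
    by (cases "i = j") (auto simp: algebra_simps)
  have collect: "((real m + 1) * x + x) / c = (real (Suc m) + 1) / c * x" for x c :: real
    by (simp add: algebra_simps)
  have pick: "(\<Sum>i\<in>UNIV. of_bool (i = j) * c) = c" for c :: real
    by (simp add: of_bool_def if_distrib[of "\<lambda>x. x * c"] cong: if_cong)
  have "multinomial_mean (Suc (Suc m)) (\<lambda>N. N j * f N) =
    (\<Sum>i\<in>UNIV. multinomial_mean (Suc m) (\<lambda>N. N j * f (?up i N)) +
                 of_bool (i = j) * multinomial_mean (Suc m) (\<lambda>N. f (?up j N))) / CARD('d)"
    by (subst multinomial_mean.simps(2))
       (simp only: split multinomial_mean_add multinomial_mean_cmult)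
  also have "(\<Sum>i\<in>UNIV. multinomial_mean (Suc m) (\<lambda>N. N j * f (?up i N)) +
                 of_bool (i = j) * multinomial_mean (Suc m) (\<lambda>N. f (?up j N))) =
     (real m + 1) * ((\<Sum>i\<in>UNIV. multinomial_mean m (\<lambda>N. f (?up j (?up i N)))) / CARD('d)) +
       multinomial_mean (Suc m) (\<lambda>N. f (?up j N))"
    unfolding sum.distrib Suc.IH comm pick
    by (simp only: sum_distrib_left sum_divide_distrib times_divide_eq_left times_divide_eq_right
        of_nat_add of_nat_1 of_nat_Suc)
  also have "(\<Sum>i\<in>UNIV. multinomial_mean m (\<lambda>N. f (?up j (?up i N)))) / CARD('d) =
      multinomial_mean (Suc m) (\<lambda>N. f (?up j N))"
    by simp
  finally show ?case unfolding collect .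
qed

text \<open>
  Reading the size-bias identity backwards removes one factor \<open>1 / (N j + 1)\<close> at the price of
  \<open>CARD('d) / (m + 1)\<close> and of one additional choice.
\<close>

lemma multinomial_mean_prod_reciprocals:
  assumes "finite I" "0 < m"
  shows "multinomial_mean m (\<lambda>N :: 'd::finite \<Rightarrow> nat. \<Prod>i\<in>I. 1 / (real (N i) + 1)) \<le> (CARD('d) / m) ^ card I"
  using assms
proof (induction I arbitrary: m rule: finite_induct)
  case (insert j I)
  define f where "f N = (1 / N j) * (\<Prod>i\<in>I. 1 / (real (N i) + 1))" for N :: "'d \<Rightarrow> nat"
  have upd: "f (N(j := Suc (N j))) = (\<Prod>i\<in>insert j I. 1 / (real (N i) + 1))" for N
  proof -
    have "(\<Prod>i\<in>I. 1 / ((N(j := Suc (N j))) i + 1)) = (\<Prod>i\<in>I. 1 / (real (N i) + 1))"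
      using insert.hyps by (intro prod.cong) auto
    thus ?thesis unfolding f_def using insert.hyps by (simp add: add.commute)
  qed
  have "multinomial_mean m (\<lambda>N. \<Prod>i\<in>insert j I. 1 / (real (N i) + 1)) =
        CARD('d) / (real m + 1) * multinomial_mean (Suc m) (\<lambda>N. N j * f N)"
    unfolding multinomial_mean_size_bias upd using insert.prems by (simp add: add.commute[of 1])
  also have "\<dots> \<le> CARD('d) / (real m + 1) * multinomial_mean (Suc m) (\<lambda>N. \<Prod>i\<in>I. 1 / (real (N i) + 1))"
    unfolding f_def by (intro mult_left_mono multinomial_mean_mono) (auto intro!: prod_nonneg)
  also have "\<dots> \<le> CARD('d) / (real m + 1) * (CARD('d) / Suc m) ^ card I"
    by (intro mult_left_mono insert.IH) auto
  also have "\<dots> \<le> CARD('d) / m * (CARD('d) / m) ^ card I"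
    using insert.prems by (intro mult_mono power_mono divide_left_mono) auto
  finally show ?case using insert.hyps by simp
qed (simp add: multinomial_mean_const)

text \<open>
  Jensen's inequality for the square root. It is derived from \<open>2 a s \<le> a\<^sup>2 + s\<^sup>2\<close>, with \<open>a\<close> the
  square root of the bound on the mean of \<open>s\<^sup>2\<close>.
\<close>

lemma multinomial_mean_prod_sqrt:
  assumes "0 < m"
  shows "multinomial_mean m (\<lambda>N :: 'd::finite \<Rightarrow> nat. \<Prod>i\<in>UNIV. 1 / sqrt (real (N i) + 1))
           \<le> (CARD('d) / m) powr (CARD('d) / 2)"
proof -
  define a where "a = (CARD('d) / m) powr (CARD('d) / 2)"
  have a: "a > 0" using assms by (simp add: a_def)
  have a2: "a\<^sup>2 = (CARD('d) / m) ^ CARD('d)"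
    using assms by (simp add: a_def powr_powr powr_realpow flip: powr_numeral)
  have "multinomial_mean m (\<lambda>N :: 'd \<Rightarrow> nat. \<Prod>i\<in>UNIV. 1 / sqrt (real (N i) + 1)) \<le>
        multinomial_mean m (\<lambda>N :: 'd \<Rightarrow> nat. a / 2 + 1 / (2 * a) * (\<Prod>i\<in>UNIV. 1 / (real (N i) + 1)))"
  proof (rule multinomial_mean_mono)
    fix N :: "'d \<Rightarrow> nat"
    let ?s = "\<Prod>i\<in>UNIV. 1 / sqrt (real (N i) + 1)"
    have s2: "(\<Prod>i\<in>UNIV. 1 / (real (N i) + 1)) = ?s\<^sup>2"
      by (simp add: power2_eq_square flip: prod.distrib)
    have "2 * a * ?s \<le> a\<^sup>2 + ?s\<^sup>2"
      using zero_le_power2[of "a - ?s"] by (simp add: power2_diff algebra_simps)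
    thus "?s \<le> a / 2 + 1 / (2 * a) * (\<Prod>i\<in>UNIV. 1 / (real (N i) + 1))"
      unfolding s2 using a by (simp add: field_simps power2_eq_square)
  qed
  also have "\<dots> \<le> a / 2 + 1 / (2 * a) * a\<^sup>2"
    unfolding multinomial_mean_add multinomial_mean_cmult multinomial_mean_const a2
    using a multinomial_mean_prod_reciprocals[OF finite assms]
    by (intro add_left_mono mult_left_mono) auto
  also have "\<dots> = a" using a by (simp add: power2_eq_square)
  finally show ?thesis by (simp add: a_def)
qed

section \<open>A Gaussian bound for the simple random walk on the lattice\<close>

primrec lattice_walk :: "nat \<Rightarrow> int ^ 'd::finite \<Rightarrow> real" where
  "lattice_walk 0 z = of_bool (z = 0)"
| "lattice_walk (Suc m) z =
     (\<Sum>i\<in>UNIV. (lattice_walk m (z - axis i 1) + lattice_walk m (z + axis i 1)) / 2) / CARD('d)"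

lemma lattice_walk_nonneg: "0 \<le> lattice_walk m z"
  by (induction m arbitrary: z) (auto intro!: divide_nonneg_nonneg sum_nonneg)

text \<open>
  Given the numbers of steps in the coordinate directions, the coordinates are independent walks
  on the line.
\<close>

lemma lattice_walk_factor:
  fixes z :: "int ^ 'd::finite"
  shows "lattice_walk m z = multinomial_mean m (\<lambda>N. \<Prod>i\<in>UNIV. line_walk (N i) (z $ i))"
proof (induction m arbitrary: z)
  case 0
  show ?case
  proof (cases "z = 0")
    case False
    then obtain i where "z $ i \<noteq> 0" by (auto simp: vec_eq_iff)
    hence "(\<Prod>i\<in>UNIV. line_walk 0 (z $ i)) = 0" by (intro prod_zero) auto
    with False show ?thesis by simp
  qed simp
next
  case (Suc m)
  have step: "(\<Prod>j\<in>UNIV. line_walk ((N(i := Suc (N i))) j) (z $ j)) =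
     1/2 * ((\<Prod>j\<in>UNIV. line_walk (N j) ((z - axis i 1) $ j)) +
      (\<Prod>j\<in>UNIV. line_walk (N j) ((z + axis i 1) $ j)))" for N :: "'d \<Rightarrow> nat" and i
  proof -
    have peel: "(\<Prod>j\<in>UNIV. g j) = g i * (\<Prod>j\<in>UNIV - {i}. g j)" for g :: "'d \<Rightarrow> real"
      by (rule prod.remove) auto
    have rest: "(\<Prod>j\<in>UNIV - {i}. line_walk ((N(i := Suc (N i))) j) (z $ j)) =
          (\<Prod>j\<in>UNIV - {i}. line_walk (N j) (z $ j))"
      "(\<Prod>j\<in>UNIV - {i}. line_walk (N j) ((z - axis i 1) $ j)) =
          (\<Prod>j\<in>UNIV - {i}. line_walk (N j) (z $ j))"
      "(\<Prod>j\<in>UNIV - {i}. line_walk (N j) ((z + axis i 1) $ j)) =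
          (\<Prod>j\<in>UNIV - {i}. line_walk (N j) (z $ j))"
      by (intro prod.cong; auto simp: axis_def)+
    show ?thesis unfolding peel rest by (simp add: algebra_simps)
  qed
  show ?case
    unfolding multinomial_mean.simps lattice_walk.simps Suc step
      multinomial_mean_cmult multinomial_mean_add by simp
qed

lemma lattice_norm_square: "(lattice_norm z)\<^sup>2 = (\<Sum>i\<in>UNIV. (real_of_int (z $ i))\<^sup>2)"
  by (simp add: lattice_norm_def norm_vec_def L2_set_def sum_nonneg)

text \<open>
  Every \<open>N i\<close> is at most \<open>m\<close>, so the Gaussian factors of the coordinates can be compared with those
  at time \<open>m\<close>, whose product is the exponential on the right. What remains is the mean of the
  prefactors \<open>1 / sqrt (N i + 1)\<close>.
\<close>

lemma lattice_walk_gauss: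
  fixes z :: "int ^ 'd::finite"
  assumes "0 < m"
  shows "lattice_walk m z \<le>
    2 ^ CARD('d) * (CARD('d) / m) powr (CARD('d) / 2) * exp (- (lattice_norm z)\<^sup>2 / (4 * (real m + 1)))"
proof -
  let ?e = "exp (- (lattice_norm z)\<^sup>2 / (4 * (real m + 1)))"
  have "lattice_walk m z \<le> multinomial_mean m
     (\<lambda>N :: 'd \<Rightarrow> nat. (2 ^ CARD('d) * ?e) * (\<Prod>i\<in>UNIV. 1 / sqrt (real (N i) + 1)))"
    unfolding lattice_walk_factor
  proof (rule multinomial_mean_mono)
    fix N :: "'d \<Rightarrow> nat" assume N: "\<And>i. N i \<le> m"
    have "(\<Prod>i\<in>UNIV. line_walk (N i) (z $ i)) \<le>
          (\<Prod>i\<in>UNIV. 2 * exp (- (real_of_int (z $ i))\<^sup>2 / (4 * (real m + 1))) * (1 / sqrt (real (N i) + 1)))"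
    proof (rule prod_mono, safe)
      fix i
      have "line_walk (N i) (z $ i) \<le> 2 / sqrt (real (N i) + 1) * exp (- (real_of_int (z $ i))\<^sup>2 / (4 * (real (N i) + 1)))"
        by (rule line_walk_gauss)
      also have "\<dots> \<le> 2 / sqrt (real (N i) + 1) * exp (- (real_of_int (z $ i))\<^sup>2 / (4 * (real m + 1)))"
        using N[of i] by (intro mult_left_mono) (auto simp: frac_le)
      finally show "line_walk (N i) (z $ i) \<le>
          2 * exp (- (real_of_int (z $ i))\<^sup>2 / (4 * (real m + 1))) * (1 / sqrt (real (N i) + 1))" by simp
    qed (rule line_walk_nonneg)
    also have "\<dots> = 2 ^ CARD('d) * ?e * (\<Prod>i\<in>UNIV. 1 / sqrt (real (N i) + 1))"
      unfolding prod.distrib lattice_norm_square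
      by (simp add: sum_divide_distrib sum_negf flip: exp_sum)
    finally show "(\<Prod>i\<in>UNIV. line_walk (N i) (z $ i)) \<le>
      2 ^ CARD('d) * ?e * (\<Prod>i\<in>UNIV. 1 / sqrt (real (N i) + 1))" .
  qed
  also have "\<dots> \<le> 2 ^ CARD('d) * ?e * (CARD('d) / m) powr (CARD('d) / 2)"
    unfolding multinomial_mean_cmult using multinomial_mean_prod_sqrt[OF assms, where 'd='d]
    by (intro mult_left_mono) auto
  finally show ?thesis by (simp add: mult_ac)
qed

lemma powr_le_exp:
  fixes x q :: real
  assumes "0 < q" "0 \<le> x"
  shows "x powr q \<le> q powr q * exp x"
proof -
  have "x / q \<le> exp (x / q)"
    using exp_ge_add_one_self[of "x / q"] by linarith
  hence "(x / q) powr q \<le> exp (x / q) powr q"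
    using assms by (intro powr_mono2) auto
  also have "\<dots> = exp x" using assms by (simp add: powr_def)
  finally show ?thesis using assms by (simp add: powr_divide field_simps)
qed

text \<open>
  The only two consequences of the Gaussian bound needed later. A Gaussian beats every power, so
  with \<open>R = |z|\<^sup>2\<close> the exponential may be replaced by a multiple of \<open>(m / R) powr q\<close>; the
  exponent \<open>q = d / 2\<close> turns \<open>m powr (- d / 2)\<close> into \<open>R powr (- d / 2)\<close>, and \<open>q = d / 2 + 1\<close>
  yields the extra factor \<open>m / R\<close>. Thus at large distance the walk depends on time only through
  \<open>min 1 (m / R)\<close>.
\<close>

lemma lattice_walk_local_bounds:
  obtains C where "C > 0"
    "\<And>m (z :: int ^ 'd::finite). 0 < m \<Longrightarrow> lattice_walk m z \<le> C * real m powr (- (CARD('d) / 2))"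
    "\<And>m (z :: int ^ 'd::finite). 0 < m \<Longrightarrow> z \<noteq> 0 \<Longrightarrow>
       lattice_walk m z \<le> C / lattice_norm z ^ CARD('d) * min 1 (m / (lattice_norm z)\<^sup>2)"
proof -
  define d :: real where "d = CARD('d)"
  have d: "d \<ge> 1" unfolding d_def using Suc_leI[OF zero_less_card_finite[where 'a='d]] by simp
  define D where "D = 2 ^ CARD('d) * d powr (d / 2)"
  have D: "D > 0" using d by (simp add: D_def)
  \<comment> \<open>The constant for which \<open>exp (- u / 8) \<le> K q * u powr (- q)\<close>; the 8 arises from \<open>4 * (m + 1) \<le> 8 * m\<close>.\<close>
  define K where "K q = (8 * q) powr q" for q :: real
  define C where "C = D * (1 + K (d / 2) + K (d / 2 + 1))"
  have K: "K q \<ge> 0" for q by (simp add: K_def)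
  have gauss: "lattice_walk m z \<le> D * real m powr (- (d / 2)) * exp (- (lattice_norm z)\<^sup>2 / (4 * (real m + 1)))"
    if "0 < m" for m and z :: "int ^ 'd"
    using lattice_walk_gauss[OF that, of z] that d
    by (simp add: D_def powr_divide powr_minus divide_simps flip: d_def)
  have C: "D \<le> C" "D * K (d / 2) \<le> C" "D * K (d / 2 + 1) \<le> C"
    using D K[of "d / 2"] K[of "d / 2 + 1"] unfolding C_def by (auto simp: algebra_simps)
  show ?thesis
  proof (rule that[of C])
    show "C > 0" using C D by linarith
  next
    fix m :: nat and z :: "int ^ 'd"
    assume m: "0 < m"
    have "lattice_walk m z \<le> D * real m powr (- (d / 2)) * 1"
      by (rule order.trans[OF gauss[OF m] mult_left_mono]) (use D in auto)
    also have "\<dots> \<le> C * real m powr (- (d / 2))"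
      using C by (simp add: mult_right_mono)
    finally show "lattice_walk m z \<le> C * real m powr (- (CARD('d) / 2))"
      by (simp add: d_def)
  next
    fix m :: nat and z :: "int ^ 'd"
    assume m: "0 < m" and z: "z \<noteq> 0"
    define R where "R = (lattice_norm z)\<^sup>2"
    from z obtain i where "z $ i \<noteq> 0" by (auto simp: vec_eq_iff)
    hence "(\<chi> i. real_of_int (z $ i)) \<noteq> 0" by (auto simp: vec_eq_iff)
    hence norm: "lattice_norm z > 0" by (simp add: lattice_norm_def)
    hence R: "R > 0" by (simp add: R_def)
    have Rd: "R powr (- (d / 2)) = 1 / lattice_norm z ^ CARD('d)"
    proof -
      have "R powr (- (d / 2)) = lattice_norm z powr (- d)"
        unfolding R_def using norm by (simp add: powr_powr flip: powr_numeral)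
      thus ?thesis using norm by (simp add: powr_minus d_def powr_realpow inverse_eq_divide)
    qed
    have decay: "lattice_walk m z \<le> C * (R powr (- (d / 2)) * (m / R) powr (q - d / 2))"
      if q: "q > 0" "D * K q \<le> C" for q
    proof -
      have "exp (- R / (4 * (real m + 1))) \<le> exp (- (R / (8 * m)))"
        using R m by (simp add: divide_left_mono)
      also have "\<dots> \<le> K q * (m / R) powr q"
      proof -
        have "(R / (8 * m)) powr q \<le> q powr q * exp (R / (8 * m))"
          using R q by (intro powr_le_exp) auto
        thus ?thesis using R m q
          by (simp add: K_def powr_divide powr_mult exp_minus field_simps)
      qed
      finally have e: "exp (- R / (4 * (real m + 1))) \<le> K q * (m / R) powr q" .
      have "lattice_walk m z \<le> D * real m powr (- (d / 2)) * (K q * (m / R) powr q)"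
        by (rule order.trans[OF gauss[OF m] mult_left_mono]) (use D e R_def in auto)
      also have "\<dots> = D * K q * (R powr (- (d / 2)) * (m / R) powr (q - d / 2))"
      proof -
        have "(m / R) powr q = (m / R) powr (d / 2) * (m / R) powr (q - d / 2)"
          by (simp flip: powr_add)
        moreover have "real m powr (- (d / 2)) * (m / R) powr (d / 2) = R powr (- (d / 2))"
          using R m by (simp add: powr_minus powr_divide field_simps)
        ultimately show ?thesis by (simp add: mult_ac)
      qed
      also have "\<dots> \<le> C * (R powr (- (d / 2)) * (m / R) powr (q - d / 2))"
        using q by (intro mult_right_mono) auto
      finally show ?thesis .
    qed
    have "lattice_walk m z \<le> C * R powr (- (d / 2))"
      using decay[of "d / 2"] C d R m by simp
    moreover have "lattice_walk m z \<le> C * R powr (- (d / 2)) * (m / R)"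
      using decay[of "d / 2 + 1"] C d R m by simp
    ultimately have "lattice_walk m z \<le> C * R powr (- (d / 2)) * min 1 (m / R)"
      by (simp add: min_def)
    thus "lattice_walk m z \<le> C / lattice_norm z ^ CARD('d) * min 1 (m / (lattice_norm z)\<^sup>2)"
      unfolding Rd R_def[symmetric] by simp
  qed
qed

section \<open>The subordinate walk as a mixture of simple random walks\<close>

text \<open>
  An i.i.d. sequence is its first entry followed by an independent copy of itself. This gives
  recursions for the laws of partial sums, on the space of steps and on the space of increments
  of the random time alike.
\<close>

lemma nn_integral_iid_first_step:
  fixes p :: "'a pmf"
  assumes [measurable]: "f \<in> borel_measurable (\<Pi>\<^sub>M k\<in>(UNIV :: nat set). measure_pmf p)"
  shows "(\<integral>\<^sup>+\<omega>. f \<omega> \<partial>(\<Pi>\<^sub>M k\<in>UNIV. measure_pmf p)) =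
         (\<integral>\<^sup>+s. \<integral>\<^sup>+\<omega>. f (case_nat s \<omega>) \<partial>(\<Pi>\<^sub>M k\<in>UNIV. measure_pmf p) \<partial>measure_pmf p)"
proof -
  interpret sequence_space "measure_pmf p"
    by unfold_locales
  have "(\<integral>\<^sup>+\<omega>. f \<omega> \<partial>S) = (\<integral>\<^sup>+\<omega>. f \<omega> \<partial>(distr (measure_pmf p \<Otimes>\<^sub>M S) S (\<lambda>(s, \<omega>). case_nat s \<omega>)))"
    by (simp only: PiM_iter)
  also have "\<dots> = (\<integral>\<^sup>+x. f (case_nat (fst x) (snd x)) \<partial>(measure_pmf p \<Otimes>\<^sub>M S))"
    by (subst nn_integral_distr) (auto simp: split_beta')
  also have "\<dots> = (\<integral>\<^sup>+s. \<integral>\<^sup>+\<omega>. f (case_nat s \<omega>) \<partial>S \<partial>measure_pmf p)"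
    by (subst nn_integral_fst[symmetric]) auto
  finally show ?thesis .
qed

lemma measurable_partial_sum:
  fixes p :: "'a :: {countable, comm_monoid_add} pmf"
  shows "(\<lambda>\<omega>. \<Sum>k<m. \<omega> k) \<in>
    measurable (\<Pi>\<^sub>M k\<in>(UNIV :: nat set). measure_pmf p) (count_space UNIV)"
proof (induction m)
  case (Suc m)
  have comp: "(\<lambda>\<omega>. \<omega> m) \<in> measurable (\<Pi>\<^sub>M k\<in>(UNIV :: nat set). measure_pmf p) (count_space UNIV)"
    using measurable_component_singleton[of m UNIV "\<lambda>_. measure_pmf p"]
    by (simp cong: measurable_cong_sets)
  have "(\<lambda>\<omega>. (\<Sum>k<m. \<omega> k) + \<omega> m) \<in> measurable (\<Pi>\<^sub>M k\<in>(UNIV :: nat set). measure_pmf p) (count_space UNIV)"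
  proof (rule measurable_compose_countable[OF _ Suc])
    show "(\<lambda>\<omega>. i + \<omega> m) \<in> measurable (\<Pi>\<^sub>M k\<in>(UNIV :: nat set). measure_pmf p) (count_space UNIV)" for i
      by (rule measurable_compose[OF comp]) simp
  qed
  thus ?case by simp
qed simp

lemma nn_integral_partial_sum_Suc:
  fixes p :: "'a :: {countable, comm_monoid_add} pmf"
  shows "(\<integral>\<^sup>+\<omega>. g (\<Sum>k<Suc m. \<omega> k) \<partial>(\<Pi>\<^sub>M k\<in>UNIV. measure_pmf p)) =
         (\<integral>\<^sup>+s. \<integral>\<^sup>+\<omega>. g (s + (\<Sum>k<m. \<omega> k)) \<partial>(\<Pi>\<^sub>M k\<in>UNIV. measure_pmf p) \<partial>measure_pmf p)"
proof -
  have "(\<lambda>\<omega>. g (\<Sum>k<Suc m. \<omega> k)) \<in> borel_measurable (\<Pi>\<^sub>M k\<in>(UNIV :: nat set). measure_pmf p)"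
    by (rule measurable_compose[OF measurable_partial_sum]) simp
  from nn_integral_iid_first_step[OF this] show ?thesis
    by (simp add: sum.lessThan_Suc_shift del: sum.lessThan_Suc)
qed

lemma sum_unit_steps:
  fixes g :: "int ^ 'd::finite \<Rightarrow> real"
  shows "(\<Sum>s\<in>unit_steps. g s) = (\<Sum>i\<in>UNIV. g (axis i 1) + g (- axis i 1))"
proof -
  have inj: "inj (\<lambda>i::'d. axis i (1::int))" "inj (\<lambda>i::'d. - axis i (1::int))"
    by (auto simp: inj_def axis_eq_axis)
  have "axis i 1 \<noteq> - axis j (1::int)" for i j :: 'd
  proof
    assume "axis i 1 = - axis j (1::int)"
    hence "axis i 1 $ i = (- axis j (1::int)) $ i" by simp
    thus False by (auto simp: axis_def split: if_splits)
  qed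
  hence "range (\<lambda>i::'d. axis i (1::int)) \<inter> range (\<lambda>i. - axis i 1) = {}" by auto
  thus ?thesis unfolding unit_steps_def
    by (simp add: sum.union_disjoint sum.reindex[OF inj(1)] sum.reindex[OF inj(2)] sum.distrib)
qed

lemma card_unit_steps: "card (unit_steps :: (int ^ 'd::finite) set) = 2 * CARD('d)"
proof -
  have "real (card (unit_steps :: (int ^ 'd::finite) set)) = (\<Sum>s\<in>(unit_steps :: (int ^ 'd) set). 1)"
    by simp
  also have "\<dots> = real (2 * CARD('d))" unfolding sum_unit_steps by simp
  finally show ?thesis by linarith
qed

lemma simple_walk_law:
  fixes w :: "int ^ 'd::finite"
  shows "(\<integral>\<^sup>+\<xi>. indicator {w} (\<Sum>k<m. \<xi> k) \<partial>(\<Pi>\<^sub>M k\<in>UNIV. measure_pmf (pmf_of_set unit_steps))) =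
         ennreal (lattice_walk m w)"
proof (induction m arbitrary: w)
  case 0
  interpret prob_space "\<Pi>\<^sub>M k\<in>(UNIV::nat set). measure_pmf (pmf_of_set (unit_steps :: (int ^ 'd) set))"
    by (intro prob_space_PiM measure_pmf.prob_space_axioms)
  show ?case by (auto simp: indicator_def emeasure_space_1)
next
  case (Suc m)
  have shift: "indicator {w} (s + v) = (indicator {w - s} v :: ennreal)" for s v
    by (auto simp: indicator_def algebra_simps)
  have "(\<integral>\<^sup>+\<xi>. indicator {w} (\<Sum>k<Suc m. \<xi> k) \<partial>(\<Pi>\<^sub>M k\<in>UNIV. measure_pmf (pmf_of_set unit_steps))) =
        (\<integral>\<^sup>+s. ennreal (lattice_walk m (w - s)) \<partial>measure_pmf (pmf_of_set unit_steps))"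
    unfolding nn_integral_partial_sum_Suc shift Suc ..
  also have "\<dots> = (\<Sum>s\<in>unit_steps. ennreal (lattice_walk m (w - s))) / ennreal (card (unit_steps :: (int ^ 'd) set))"
    by (simp add: nn_integral_pmf_of_set finite_unit_steps unit_steps_nonempty ennreal_of_nat_eq_real_of_nat)
  also have "\<dots> = ennreal ((\<Sum>s\<in>unit_steps. lattice_walk m (w - s)) / card (unit_steps :: (int ^ 'd) set))"
    by (simp add: lattice_walk_nonneg sum_nonneg divide_ennreal card_unit_steps)
  also have "(\<Sum>s\<in>unit_steps. lattice_walk m (w - s)) / card (unit_steps :: (int ^ 'd) set) = lattice_walk (Suc m) w"
    unfolding sum_unit_steps card_unit_steps by (simp add: field_simps flip: sum_divide_distrib)
  finally show ?case .
qed

text \<open>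
  Fubini's theorem: for a fixed trajectory of the random time, the subordinate walk at time \<open>n\<close> is
  the simple random walk at the number \<open>random_time \<rho> n\<close>.
\<close>

lemma transition_prob_mixture:
  fixes x y :: "int ^ 'd::finite"
  shows "ennreal (transition_prob \<mu> n x y) =
    (\<integral>\<^sup>+\<rho>. ennreal (lattice_walk (random_time \<rho> n) (y - x)) \<partial>(\<Pi>\<^sub>M k\<in>UNIV. measure_pmf (jump_pmf \<mu>)))"
proof -
  let ?X = "\<Pi>\<^sub>M k\<in>(UNIV :: nat set). measure_pmf (pmf_of_set (unit_steps :: (int ^ 'd) set))"
  let ?J = "\<Pi>\<^sub>M k\<in>(UNIV :: nat set). measure_pmf (jump_pmf \<mu>)"
  interpret X: prob_space ?X by (intro prob_space_PiM measure_pmf.prob_space_axioms)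
  interpret J: prob_space ?J by (intro prob_space_PiM measure_pmf.prob_space_axioms)
  interpret pair_sigma_finite ?X ?J ..
  interpret W: prob_space "walk_space \<mu> :: ((nat \<Rightarrow> int ^ 'd) \<times> _) measure"
    by (rule prob_space_walk_space)
  let ?A = "{\<omega> \<in> space (walk_space \<mu>). subordinate_walk x \<omega> n = y}"
  have A: "?A \<in> sets (walk_space \<mu>)"
    using measurable_sets[OF subordinate_walk_measurable[of x n \<mu>], of "{y}"]
    by (simp add: vimage_def Int_def conj_commute)
  have "ennreal (transition_prob \<mu> n x y) = emeasure (walk_space \<mu>) ?A"
    by (simp add: transition_prob_def W.emeasure_eq_measure)
  also have "\<dots> = (\<integral>\<^sup>+\<rho>. emeasure ?X ((\<lambda>\<xi>. (\<xi>, \<rho>)) -` ?A) \<partial>?J)"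
    using A unfolding walk_space_def by (rule emeasure_pair_measure_alt2)
  also have "\<dots> = (\<integral>\<^sup>+\<rho>. ennreal (lattice_walk (random_time \<rho> n) (y - x)) \<partial>?J)"
  proof (rule nn_integral_cong)
    fix \<rho> :: "nat \<Rightarrow> nat"
    let ?m = "random_time \<rho> n"
    have "(\<lambda>\<xi>. (\<xi>, \<rho>)) -` ?A = {\<xi> \<in> space ?X. (\<Sum>k<?m. \<xi> k) = y - x}"
      by (auto simp: walk_space_def space_pair_measure space_PiM subordinate_walk_def
          simple_walk_def algebra_simps)
    moreover have "{\<xi> \<in> space ?X. (\<Sum>k<?m. \<xi> k) = y - x} \<in> sets ?X"
      using measurable_sets[OF measurable_partial_sum[of ?m "pmf_of_set unit_steps"], of "{y - x}"]
      by (simp add: vimage_def Int_def conj_commute)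
    moreover have "(\<integral>\<^sup>+\<xi>. indicator {y - x} (\<Sum>k<?m. \<xi> k) \<partial>?X) =
      (\<integral>\<^sup>+\<xi>. indicator {\<xi> \<in> space ?X. (\<Sum>k<?m. \<xi> k) = y - x} \<xi> \<partial>?X)"
      by (rule nn_integral_cong) (auto simp: indicator_def)
    ultimately show "emeasure ?X ((\<lambda>\<xi>. (\<xi>, \<rho>)) -` ?A) = ennreal (lattice_walk ?m (y - x))"
      by (simp add: nn_integral_indicator flip: simple_walk_law)
  qed
  finally show ?thesis .
qed

section \<open>Bernstein functions and generating functions\<close>

lemma one_minus_exp_le:
  fixes l t :: real
  assumes t: "0 \<le> t" and l: "0 \<le> l"
  shows "1 - exp (- l * t) \<le> max 1 l * min 1 t"
proof -
  have "1 - exp (- l * t) \<le> l * t"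
    using exp_ge_add_one_self[of "- l * t"] by simp
  also have "\<dots> \<le> max 1 l * t" using t by (intro mult_right_mono) auto
  finally have "1 - exp (- l * t) \<le> max 1 l * t" .
  moreover have "1 - exp (- l * t) \<le> max 1 l"
    using exp_gt_zero[of "- l * t"] by (simp add: max_def del: exp_gt_zero)
  ultimately show "1 - exp (- l * t) \<le> max 1 l * min 1 t"
    by (simp add: min_def del: mult_minus_left)
qed

locale normalized_bernstein =
  fixes \<phi> :: "real \<Rightarrow> real" and \<mu> :: "real measure"
  assumes bernstein: "complete_bernstein \<phi> \<mu>" and phi_one: "\<phi> 1 = 1"
begin

lemma sets_levy [measurable_cong, simp]: "sets \<mu> = sets borel"
  using bernstein by (auto simp: complete_bernstein_def)

text \<open>
  The integrand of the representation of \<open>\<phi>\<close>, extended by zero so that the integrals run over all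
  of \<open>\<mu>\<close>.
\<close>

definition kernel :: "real \<Rightarrow> real \<Rightarrow> real" where
  "kernel l t = indicator {0<..} t * (1 - exp (- l * t))"

lemma kernel_measurable [measurable]: "kernel l \<in> borel_measurable borel"
  unfolding kernel_def by measurable

lemma kernel_nonneg: "0 \<le> l \<Longrightarrow> 0 \<le> kernel l t"
  by (auto simp: kernel_def indicator_def)

lemma kernel_mono: "a \<le> b \<Longrightarrow> kernel a t \<le> kernel b t"
  by (auto simp: kernel_def indicator_def)

lemma phi_eq: "0 \<le> l \<Longrightarrow> \<phi> l = (LINT t|\<mu>. kernel l t)"
  using bernstein by (simp add: complete_bernstein_def kernel_def set_lebesgue_integral_def)

lemma kernel_integrable:
  assumes "0 \<le> l" shows "integrable \<mu> (kernel l)"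
proof (rule integrableI_bounded)
  have fin: "(\<integral>\<^sup>+t\<in>{0<..}. ennreal (min 1 t) \<partial>\<mu>) < \<infinity>"
    using bernstein by (auto simp: complete_bernstein_def)
  have "(\<integral>\<^sup>+t. ennreal (norm (kernel l t)) \<partial>\<mu>) \<le>
        (\<integral>\<^sup>+t. ennreal (max 1 l) * (ennreal (min 1 t) * indicator {0<..} t) \<partial>\<mu>)"
  proof (rule nn_integral_mono)
    fix t :: real
    show "ennreal (norm (kernel l t)) \<le> ennreal (max 1 l) * (ennreal (min 1 t) * indicator {0<..} t)"
      using one_minus_exp_le[of t l] assms kernel_nonneg[of l t]
      by (auto simp: kernel_def indicator_def simp flip: ennreal_mult intro!: ennreal_leI)
  qed
  also have "\<dots> = ennreal (max 1 l) * (\<integral>\<^sup>+t\<in>{0<..}. ennreal (min 1 t) \<partial>\<mu>)"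
    by (rule nn_integral_cmult) measurable
  also have "\<dots> < \<infinity>" using fin by (simp add: ennreal_mult_less_top)
  finally show "(\<integral>\<^sup>+t. ennreal (norm (kernel l t)) \<partial>\<mu>) < \<infinity>" .
qed measurable

lemma phi_nonneg: "0 \<le> l \<Longrightarrow> 0 \<le> \<phi> l"
  by (simp add: phi_eq kernel_nonneg)

lemma phi_mono: "0 \<le> a \<Longrightarrow> a \<le> b \<Longrightarrow> \<phi> a \<le> \<phi> b"
  using phi_eq[of a] phi_eq[of b] by (auto intro!: integral_mono kernel_integrable kernel_mono)

text \<open>
  Concavity of \<open>\<phi>\<close> between \<open>0\<close> and \<open>l\<close>, inherited from \<open>\<lambda>l. 1 - exp (- l * t)\<close>.
\<close>

lemma phi_scale:
  assumes "0 \<le> s" "s \<le> 1" "0 \<le> l" shows "s * \<phi> l \<le> \<phi> (s * l)"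
proof -
  have "s * \<phi> l = (LINT t|\<mu>. s * kernel l t)" using assms by (simp add: phi_eq)
  also have "\<dots> \<le> (LINT t|\<mu>. kernel (s * l) t)"
  proof (intro integral_mono)
    fix t :: real
    have "exp ((1 - s) * 0 + s * (- l * t)) \<le> (1 - s) * exp 0 + s * exp (- l * t)"
      using convex_onD[OF exp_convex, of s 0 "- l * t"] assms by simp
    thus "s * kernel l t \<le> kernel (s * l) t"
      by (auto simp: kernel_def indicator_def algebra_simps)
  qed (use assms in \<open>auto intro!: kernel_integrable integrable_mult_right\<close>)
  also have "\<dots> = \<phi> (s * l)" using assms by (simp add: phi_eq)
  finally show ?thesis .
qed

lemma phi_pos: assumes "0 < l" shows "0 < \<phi> l"
proof (cases "l \<le> 1")
  case True
  thus ?thesis using phi_scale[of l 1] assms phi_one by simp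
next
  case False
  thus ?thesis using phi_mono[of 1 l] phi_one by simp
qed

text \<open>
  If \<open>\<phi> a = \<phi> b\<close> with \<open>a < b\<close>, the integrands agree almost everywhere, so \<open>\<mu>\<close> vanishes on
  \<open>(0,\<infinity>)\<close>, which contradicts \<open>\<phi> b > 0\<close>.
\<close>

lemma phi_strict_mono:
  assumes "0 \<le> a" "a < b" shows "\<phi> a < \<phi> b"
proof -
  have b: "0 < \<phi> b" "0 < b" using assms phi_pos by auto
  have "\<phi> a \<noteq> \<phi> b"
  proof
    assume "\<phi> a = \<phi> b"
    hence "(LINT t|\<mu>. kernel b t - kernel a t) = 0"
      using assms by (simp add: phi_eq kernel_integrable)
    moreover have "integrable \<mu> (\<lambda>t. kernel b t - kernel a t)"
      using assms by (intro Bochner_Integration.integrable_diff kernel_integrable) auto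
    moreover have "0 \<le> kernel b t - kernel a t" for t
      using assms kernel_mono[of a b t] by simp
    ultimately have "AE t in \<mu>. kernel b t - kernel a t = 0"
      by (subst (asm) integral_nonneg_eq_0_iff_AE) auto
    hence "AE t in \<mu>. kernel b t = 0"
      by eventually_elim (use assms in \<open>auto simp: kernel_def indicator_def split: if_splits\<close>)
    hence "\<phi> b = 0" using b by (simp add: phi_eq integral_eq_zero_AE)
    with b show False by simp
  qed
  thus ?thesis using phi_mono[of a b] assms by simp
qed

text \<open>
  Monotonicity and concavity bound the difference quotients of \<open>\<phi>\<close> on \<open>[e, 1]\<close> by \<open>1 / e\<close>.
\<close>

lemma phi_continuous_on:
  assumes e: "0 < e"
  shows "continuous_on {e..1} \<phi>"
proof -
  have lip: "\<phi> b - \<phi> a \<le> 1 / e * (b - a)" if "e \<le> a" "a \<le> b" "b \<le> 1" for a b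
  proof -
    have "a / b * \<phi> b \<le> \<phi> (a / b * b)" using that e by (intro phi_scale) auto
    hence "\<phi> b - \<phi> a \<le> \<phi> b * (b - a) / b" using that e by (simp add: field_simps)
    also have "\<dots> \<le> 1 * (b - a) / e"
      using that e phi_mono[of b 1] phi_one phi_nonneg[of b] by (intro frac_le mult_right_mono) auto
    finally show ?thesis by simp
  qed
  have "(1 / e)-lipschitz_on {e..1} \<phi>"
  proof (rule lipschitz_onI)
    fix a b assume ab: "a \<in> {e..1}" "b \<in> {e..1}"
    show "dist (\<phi> a) (\<phi> b) \<le> 1 / e * dist a b"
    proof (cases "a \<le> b")
      case True
      thus ?thesis using ab e lip[of a b] phi_mono[of a b] by (simp add: dist_real_def)
    next
      case False
      thus ?thesis using ab e lip[of b a] phi_mono[of b a] by (simp add: dist_real_def)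
    qed
  qed (use e in simp)
  thus ?thesis by (rule lipschitz_on_continuous_on)
qed

text \<open>
  Exchanging sum and integral, the weights \<open>t ^ k * exp (- t) / fact k\<close> turn the generating function
  into the integral of \<open>exp (- (1 - s) * t) - exp (- t)\<close>, that is, into \<open>\<phi> 1 - \<phi> (1 - s)\<close>.
\<close>

lemma jump_generating_function:
  assumes s: "0 \<le> s" "s \<le> 1"
  shows "(\<integral>\<^sup>+k. ennreal (s ^ k) \<partial>measure_pmf (jump_pmf \<mu>)) = ennreal (1 - \<phi> (1 - s))"
proof -
  let ?h = "\<lambda>k t::real. indicator {0<..} t * (if k = 0 then 0 else t ^ k * exp (- t) / fact k)"
  let ?g = "\<lambda>t. kernel 1 t - kernel (1 - s) t"
  have h_nonneg: "0 \<le> ?h k t" for k t by (auto simp: indicator_def)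
  have h_sums: "(\<lambda>k. ?h k t) sums kernel 1 t" for t
    using sums_mult[OF poisson_weight_sums[of t]] by (simp add: kernel_def)
  have h_le: "?h k t \<le> kernel 1 t" for k t
    using sum_le_suminf[OF sums_summable[OF h_sums], of "{k}" t] h_nonneg sums_unique[OF h_sums[of t]]
    by (simp only: finite.intros sum.insert sum.empty empty_iff if_False simp_thms ball_simps
        insert_iff subset_UNIV add_0_right)
  have h_int: "integrable \<mu> (?h k)" for k
  proof (rule Bochner_Integration.integrable_bound[OF kernel_integrable[of 1]])
    show "AE t in \<mu>. norm (?h k t) \<le> norm (kernel 1 t)"
      using h_nonneg h_le kernel_nonneg[of 1] by (intro AE_I2) (simp only: real_norm_def abs_of_nonneg zero_le_one)
  qed (simp, measurable)
  have pmf: "ennreal (pmf (jump_pmf \<mu>) k) = (\<integral>\<^sup>+t. ennreal (?h k t) \<partial>\<mu>)" for k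
  proof -
    have "pmf (jump_pmf \<mu>) k = (LINT t|\<mu>. ?h k t)"
      unfolding pmf_jump_pmf[OF bernstein phi_one]
      by (simp add: jump_weight_def set_lebesgue_integral_def flip: integral_mult_right_zero)
    thus ?thesis using nn_integral_eq_integral[OF h_int AE_I2[OF h_nonneg]] by simp
  qed
  \<comment> \<open>The Poisson series at \<open>s * t\<close>, multiplied by \<open>exp (- (1 - s) * t)\<close>.\<close>
  have sum: "(\<lambda>k. ?h k t * s ^ k) sums ?g t" for t
  proof -
    have "(\<lambda>k. indicator {0<..} t * exp (- (1 - s) * t) *
            (if k = 0 then 0 else (s * t) ^ k * exp (- (s * t)) / fact k)) sums
          (indicator {0<..} t * exp (- (1 - s) * t) * (1 - exp (- (s * t))))"
      by (rule sums_mult[OF poisson_weight_sums])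
    moreover have "exp (- (1 - s) * t) * exp (- (s * t)) = exp (- t)"
      by (simp add: algebra_simps flip: exp_add)
    hence "indicator {0<..} t * exp (- (1 - s) * t) *
            (if k = 0 then 0 else (s * t) ^ k * exp (- (s * t)) / fact k) = ?h k t * s ^ k" for k
      by (auto simp: indicator_def power_mult_distrib)
    moreover have "indicator {0<..} t * exp (- (1 - s) * t) * (1 - exp (- (s * t))) = ?g t"
      using \<open>exp (- (1 - s) * t) * exp (- (s * t)) = exp (- t)\<close>
      by (auto simp: kernel_def indicator_def right_diff_distrib)
    ultimately show ?thesis by (simp only:)
  qed
  have "(\<integral>\<^sup>+k. ennreal (s ^ k) \<partial>measure_pmf (jump_pmf \<mu>)) =
        (\<Sum>k. \<integral>\<^sup>+t. ennreal (?h k t * s ^ k) \<partial>\<mu>)"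
  proof -
    have "ennreal (pmf (jump_pmf \<mu>) k) * ennreal (s ^ k) = (\<integral>\<^sup>+t. ennreal (?h k t * s ^ k) \<partial>\<mu>)" for k
      unfolding pmf ennreal_mult[OF h_nonneg zero_le_power[OF s(1)]]
      by (rule nn_integral_multc[symmetric]) measurable
    thus ?thesis unfolding nn_integral_measure_pmf nn_integral_count_space_nat by simp
  qed
  also have "\<dots> = (\<integral>\<^sup>+t. (\<Sum>k. ennreal (?h k t * s ^ k)) \<partial>\<mu>)"
    by (rule nn_integral_suminf[symmetric]) measurable
  also have "\<dots> = (\<integral>\<^sup>+t. ennreal (?g t) \<partial>\<mu>)"
    by (intro nn_integral_cong suminf_ennreal_eq[OF mult_nonneg_nonneg[OF h_nonneg zero_le_power[OF s(1)]] sum])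
  also have "\<dots> = ennreal (LINT t|\<mu>. ?g t)"
    using s by (intro nn_integral_eq_integral Bochner_Integration.integrable_diff kernel_integrable AE_I2)
      (auto intro!: kernel_mono)
  also have "(LINT t|\<mu>. ?g t) = 1 - \<phi> (1 - s)"
    using s by (simp add: kernel_integrable phi_one flip: phi_eq)
  finally show ?thesis .
qed

abbreviation "jumps \<equiv> \<Pi>\<^sub>M k\<in>(UNIV :: nat set). measure_pmf (jump_pmf \<mu>)"

lemma prob_space_jumps: "prob_space jumps"
  by (intro prob_space_PiM measure_pmf.prob_space_axioms)

lemma measurable_random_time [measurable]:
  "(\<lambda>\<rho>. random_time \<rho> n) \<in> measurable jumps (count_space UNIV)"
  unfolding random_time_def by (rule measurable_partial_sum)

lemma phi_le_one: "0 \<le> l \<Longrightarrow> l \<le> 1 \<Longrightarrow> \<phi> l \<le> 1"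
  using phi_mono[of l 1] phi_one by simp

lemma time_generating_function:
  assumes s: "0 \<le> s" "s \<le> 1"
  shows "(\<integral>\<^sup>+\<rho>. ennreal (s ^ random_time \<rho> n) \<partial>jumps) = ennreal ((1 - \<phi> (1 - s)) ^ n)"
proof (induction n)
  case 0
  show ?case using prob_space.emeasure_space_1[OF prob_space_jumps] by (simp add: random_time_def)
next
  case (Suc n)
  have "(\<integral>\<^sup>+\<rho>. ennreal (s ^ random_time \<rho> (Suc n)) \<partial>jumps) =
        (\<integral>\<^sup>+k. \<integral>\<^sup>+\<rho>. ennreal (s ^ k) * ennreal (s ^ random_time \<rho> n) \<partial>jumps \<partial>measure_pmf (jump_pmf \<mu>))"
    unfolding random_time_def
      nn_integral_partial_sum_Suc[where g = "\<lambda>j. ennreal (s ^ j)"]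
    using s by (simp add: power_add ennreal_mult)
  also have "\<dots> = (\<integral>\<^sup>+k. ennreal (s ^ k) * ennreal ((1 - \<phi> (1 - s)) ^ n) \<partial>measure_pmf (jump_pmf \<mu>))"
    by (simp add: nn_integral_cmult Suc)
  also have "\<dots> = ennreal (1 - \<phi> (1 - s)) * ennreal ((1 - \<phi> (1 - s)) ^ n)"
    by (simp add: nn_integral_multc jump_generating_function[OF s])
  also have "\<dots> = ennreal ((1 - \<phi> (1 - s)) ^ Suc n)"
    using s phi_le_one[of "1 - s"] by (simp flip: ennreal_mult)
  finally show ?case .
qed

end

section \<open>Moments of the random time\<close>

text \<open>
  Makes the dyadic series in the bound on negative moments converge: at \<open>x = 2 ^ k\<close> the right-hand
  side is geometric.
\<close>

lemma powr_stretched_exp_bound: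
  fixes c \<alpha> p :: real
  assumes "0 < c" "0 < \<alpha>" "0 < p"
  obtains K where "K > 0" "\<And>x. 0 < x \<Longrightarrow> (2 * x) powr p * exp (- (c * x powr \<alpha>)) \<le> K / x"
proof -
  \<comment> \<open>With this exponent \<open>(x powr \<alpha>) powr q\<close> is \<open>x powr p * x\<close>.\<close>
  define q where "q = (p + 1) / \<alpha>"
  have q: "q > 0" "\<alpha> * q = p + 1" using assms by (auto simp: q_def)
  define K where "K = 2 powr p * (q / c) powr q"
  show ?thesis
  proof (rule that[of K])
    show "K > 0" using assms q by (simp add: K_def)
  next
    fix x :: real assume x: "0 < x"
    have "(c * x powr \<alpha>) powr q \<le> q powr q * exp (c * x powr \<alpha>)"
      using assms x q by (intro powr_le_exp) auto
    also have "(c * x powr \<alpha>) powr q = c powr q * (x powr p * x)"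
      using assms x q by (simp add: powr_mult powr_powr powr_add)
    finally have "x powr p * x \<le> (q / c) powr q * exp (c * x powr \<alpha>)"
      using assms q by (simp add: powr_divide field_simps)
    hence "2 powr p * (x powr p * x) \<le> 2 powr p * ((q / c) powr q * exp (c * x powr \<alpha>))"
      by (intro mult_left_mono) auto
    thus "(2 * x) powr p * exp (- (c * x powr \<alpha>)) \<le> K / x"
      using x by (simp add: K_def powr_mult exp_minus field_simps)
  qed
qed

lemma min_le_one_minus_exp:
  fixes u :: real
  assumes u: "0 \<le> u"
  shows "min 1 u \<le> 2 * (1 - exp (- u))"
proof -
  have e: "exp (- u) \<le> 1 / (1 + u)"
    using exp_ge_add_one_self[of u] u by (simp add: exp_minus field_simps)
  have "min 1 u * (1 + u) \<le> 2 * u" using u by (auto simp: min_def algebra_simps mult_left_le)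
  hence "min 1 u \<le> 2 * (1 - 1 / (1 + u))" using u by (simp add: field_simps)
  also have "\<dots> \<le> 2 * (1 - exp (- u))" using e by simp
  finally show "min 1 u \<le> 2 * (1 - exp (- u))" .
qed

text \<open>
  A negative power near zero is dominated by one term of a dyadic sum of exponentials, whose
  expectations are available from the generating function. The exponent \<open>k\<close> is the one with
  \<open>1 / 2 < 2 ^ k * T \<le> 1\<close>; the factor \<open>exp 1\<close> compensates \<open>exp (- (2 ^ k * T))\<close>.
\<close>

lemma dyadic_powr_bound:
  fixes T p :: real
  assumes "0 < T" "T \<le> 1" "0 < p"
  obtains k :: nat where "2 ^ k * T \<le> 1" "T powr (- p) \<le> (2 * 2 ^ k) powr p * (exp 1 * exp (- (2 ^ k * T)))"
proof -
  obtain j :: nat where j: "1 / T < 2 ^ j"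
    using real_arch_pow[of 2 "1 / T"] by auto
  define P where "P k \<longleftrightarrow> 1 < 2 ^ k * T" for k :: nat
  have "P j" "\<not> P 0" using j assms by (auto simp: P_def field_simps)
  have "\<exists>k. \<not> P k \<and> P (Suc k)"
  proof (rule ccontr)
    assume none: "\<nexists>k. \<not> P k \<and> P (Suc k)"
    have "\<not> P i" for i by (induction i) (use none \<open>\<not> P 0\<close> in auto)
    with \<open>P j\<close> show False by blast
  qed
  then obtain k where k: "\<not> P k" "P (Suc k)" by blast
  show ?thesis
  proof (rule that[of k])
    show le: "2 ^ k * T \<le> 1" using k by (simp add: P_def)
    have "1 / T \<le> 2 * 2 ^ k" using k(2) assms by (simp add: P_def divide_simps)
    hence up: "(1 / T) powr p \<le> (2 * 2 ^ k) powr p" using assms by (intro powr_mono2) auto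
    have "T powr (- p) = (1 / T) powr p" using assms by (simp add: powr_minus powr_divide inverse_eq_divide)
    also have "\<dots> \<le> (2 * 2 ^ k) powr p * 1"
      using up by simp
    also have "\<dots> \<le> (2 * 2 ^ k) powr p * (exp 1 * exp (- (2 ^ k * T)))"
      using le by (intro mult_left_mono) (auto simp flip: exp_add)
    finally show "T powr (- p) \<le> (2 * 2 ^ k) powr p * (exp 1 * exp (- (2 ^ k * T)))" .
  qed
qed

context normalized_bernstein
begin

text \<open>
  The truncation \<open>min 1 u\<close> is at most twice \<open>1 - exp (- u)\<close>. With \<open>s = exp (- 1 / R)\<close> the expectation
  of the latter at \<open>u = random_time \<rho> n / R\<close> is \<open>1 - (1 - \<phi> (1 - s)) ^ n\<close>; Bernoulli's inequality
  bounds it by \<open>n * \<phi> (1 - s)\<close>, and \<open>1 - s \<le> 1 / R\<close>.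
\<close>

lemma time_truncated_mean:
  assumes R: "0 < R"
  shows "(\<integral>\<^sup>+\<rho>. ennreal (min 1 (random_time \<rho> n / R)) \<partial>jumps) \<le> ennreal (2 * real n * \<phi> (1 / R))"
proof -
  interpret prob_space jumps by (rule prob_space_jumps)
  define s where "s = exp (- 1 / R)"
  have s: "0 \<le> s" "s \<le> 1" using R by (auto simp: s_def)
  let ?\<tau> = "\<lambda>\<rho>. random_time \<rho> n"
  have int: "integrable jumps (\<lambda>\<rho>. s ^ ?\<tau> \<rho>)"
    using s by (intro integrable_const_bound[where B = 1]) (auto simp: power_le_one)
  have "ennreal (LINT \<rho>|jumps. s ^ ?\<tau> \<rho>) = ennreal ((1 - \<phi> (1 - s)) ^ n)"
    using s by (simp add: nn_integral_eq_integral[OF int, symmetric] time_generating_function)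
  hence mean: "(LINT \<rho>|jumps. s ^ ?\<tau> \<rho>) = (1 - \<phi> (1 - s)) ^ n"
    using s phi_le_one[of "1 - s"] by (subst (asm) ennreal_inj) auto
  have "(\<integral>\<^sup>+\<rho>. ennreal (min 1 (?\<tau> \<rho> / R)) \<partial>jumps) \<le> (\<integral>\<^sup>+\<rho>. ennreal (2 * (1 - s ^ ?\<tau> \<rho>)) \<partial>jumps)"
  proof (intro nn_integral_mono ennreal_leI)
    fix \<rho>
    show "min 1 (?\<tau> \<rho> / R) \<le> 2 * (1 - s ^ ?\<tau> \<rho>)"
      using min_le_one_minus_exp[of "?\<tau> \<rho> / R"] R by (simp add: s_def flip: exp_of_nat_mult)
  qed
  also have "\<dots> = ennreal (LINT \<rho>|jumps. 2 * (1 - s ^ ?\<tau> \<rho>))"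
    using s int by (intro nn_integral_eq_integral) (auto simp: power_le_one)
  also have "(LINT \<rho>|jumps. 2 * (1 - s ^ ?\<tau> \<rho>)) = 2 * (1 - (1 - \<phi> (1 - s)) ^ n)"
    using int by (simp add: mean prob_space)
  also have "\<dots> \<le> 2 * (real n * \<phi> (1 - s))"
    using Bernoulli_inequality[of "- \<phi> (1 - s)" n] phi_le_one[of "1 - s"] s by simp
  also have "\<phi> (1 - s) \<le> \<phi> (1 / R)"
    using s exp_ge_add_one_self[of "- 1 / R"] by (intro phi_mono) (auto simp: s_def)
  finally show ?thesis by (simp add: ennreal_leI mult_left_mono mult.assoc)
qed

text \<open>
  The generating function at \<open>0\<close>, where \<open>0 ^ k\<close> is the indicator of \<open>k = 0\<close>.
\<close>

lemma random_time_positive: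
  assumes "0 < n" shows "AE \<rho> in jumps. 0 < random_time \<rho> n"
proof -
  have "(\<integral>\<^sup>+\<rho>. ennreal (0 ^ random_time \<rho> n) \<partial>jumps) = 0"
    using assms by (simp add: time_generating_function phi_one)
  hence "AE \<rho> in jumps. ennreal (0 ^ random_time \<rho> n) = 0"
    by (subst (asm) nn_integral_0_iff_AE) measurable
  thus ?thesis by eventually_elim (auto intro!: Nat.gr0I)
qed

lemma scaling_lower:
  assumes "scaling_condition \<phi>"
  obtains c \<alpha> where "0 < c" "0 < \<alpha>"
    "\<And>r R. 0 < r \<Longrightarrow> r \<le> R \<Longrightarrow> R \<le> 1 \<Longrightarrow> c * (R / r) powr \<alpha> * \<phi> r \<le> \<phi> R"
proof -
  from assms obtain c \<alpha> where c: "0 < c" "0 < \<alpha>"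
    and le: "\<And>r R. 0 < r \<Longrightarrow> r \<le> R \<Longrightarrow> R \<le> 1 \<Longrightarrow> c * (R / r) powr \<alpha> \<le> \<phi> R / \<phi> r"
    unfolding scaling_condition_def by metis
  show ?thesis
  proof (rule that[OF c])
    fix r R :: real assume r: "0 < r" "r \<le> R" "R \<le> 1"
    show "c * (R / r) powr \<alpha> * \<phi> r \<le> \<phi> R"
      using le[OF r] phi_pos[OF r(1)] by (simp add: field_simps)
  qed
qed

text \<open>
  The intermediate value theorem on \<open>[e, 1]\<close>, where the lower scaling bound provides \<open>e > 0\<close> with
  \<open>\<phi> e \<le> 1 / n\<close>.
\<close>

lemma inverse_phi:
  assumes "scaling_condition \<phi>" "\<phi> 0 = 0" "0 < n"
  defines "r \<equiv> the_inv_into {0..} \<phi> (1 / real n)"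
  shows "0 < r" "r \<le> 1" "\<phi> r = 1 / n"
proof -
  obtain c \<alpha> where c: "0 < c" "0 < \<alpha>"
    and le: "\<And>r R. 0 < r \<Longrightarrow> r \<le> R \<Longrightarrow> R \<le> 1 \<Longrightarrow> c * (R / r) powr \<alpha> * \<phi> r \<le> \<phi> R"
    using scaling_lower[OF assms(1)] by metis
  define e where "e = min 1 ((c / n) powr (1 / \<alpha>))"
  have e: "0 < e" "e \<le> 1" using c assms by (auto simp: e_def)
  have "\<phi> e \<le> 1 / n"
  proof -
    have "e powr \<alpha> \<le> ((c / n) powr (1 / \<alpha>)) powr \<alpha>"
      using e c by (intro powr_mono2) (auto simp: e_def)
    hence "e powr \<alpha> \<le> c / n" using c assms by (simp add: powr_powr)
    moreover have "c * \<phi> e \<le> e powr \<alpha>"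
      using le[of e 1] e c phi_one by (simp add: powr_divide field_simps)
    ultimately have "c * \<phi> e \<le> c * (1 / n)" by simp
    thus ?thesis using c by (simp only: mult_le_cancel_left_pos)
  qed
  moreover have "1 / n \<le> \<phi> 1" using assms phi_one by simp
  ultimately obtain x where x: "e \<le> x" "x \<le> 1" "\<phi> x = 1 / n"
    using IVT'[of \<phi> e "1 / n" 1] phi_continuous_on[OF e(1)] e by auto
  have "inj_on \<phi> {0..}"
    by (rule linorder_inj_onI) (use phi_strict_mono in force)+
  hence "r = x" unfolding r_def using x e by (intro the_inv_into_f_eq) auto
  thus "0 < r" "r \<le> 1" "\<phi> r = 1 / n" using x e by auto
qed

text \<open>
  With \<open>r = \<phi>\<^sup>-\<^sup>1 (1 / n)\<close> the time \<open>random_time \<rho> n\<close> is of order \<open>1 / r\<close>, and it is much smaller only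
  with tiny probability: the expectation of \<open>exp (- u * random_time \<rho> n)\<close> at \<open>u = 2 ^ k * r\<close> is at
  most \<open>exp (- n * \<phi> (u / 2))\<close>, and by concavity and lower scaling \<open>n * \<phi> (u / 2)\<close> is at least a
  multiple of \<open>2 powr (k * \<alpha>)\<close>. The scaling condition reaches only up to \<open>1\<close>, but that suffices: the
  time is at least \<open>1\<close>, so that only the scales \<open>k\<close> with \<open>2 ^ k * r \<le> 1\<close> occur.
\<close>

lemma time_negative_moment:
  assumes scal: "scaling_condition \<phi>" and phi0: "\<phi> 0 = 0" and p: "0 < p"
  obtains C where "C > 0" "\<And>n. 0 < n \<Longrightarrow>
    (\<integral>\<^sup>+\<rho>. ennreal (random_time \<rho> n powr (- p)) \<partial>jumps) \<le>
      ennreal (C * the_inv_into {0..} \<phi> (1 / real n) powr p)"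
proof -
  interpret prob_space jumps by (rule prob_space_jumps)
  obtain c \<alpha> where c: "0 < c" "0 < \<alpha>"
    and le: "\<And>r R. 0 < r \<Longrightarrow> r \<le> R \<Longrightarrow> R \<le> 1 \<Longrightarrow> c * (R / r) powr \<alpha> * \<phi> r \<le> \<phi> R"
    using scaling_lower[OF scal] by metis
  obtain K where K: "K > 0"
    and K_bound: "\<And>x. 0 < x \<Longrightarrow> (2 * x) powr p * exp (- (c / 2 * x powr \<alpha>)) \<le> K / x"
    using powr_stretched_exp_bound[of "c / 2" \<alpha> p] c p by auto
  define C where "C = 1 + exp 1 * (K * 2)"
  show ?thesis
  proof (rule that[of C])
    show "C > 0" using K by (simp add: C_def add_pos_nonneg)
  next
    fix n :: nat assume n: "0 < n"
    define r where "r = the_inv_into {0..} \<phi> (1 / real n)"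
    note r = inverse_phi[OF scal phi0 n, folded r_def]
    \<comment> \<open>The dyadic scales on which the scaling condition applies.\<close>
    define A where "A = {k :: nat. 2 ^ k * r \<le> 1}"
    have finA: "finite A"
    proof -
      obtain j :: nat where j: "1 / r < 2 ^ j" using real_arch_pow[of 2 "1 / r"] by auto
      have "A \<subseteq> {..j}"
      proof
        fix k assume "k \<in> A"
        hence "(2::real) ^ k \<le> 1 / r" using r by (simp add: A_def field_simps)
        with j have "(2::real) ^ k < 2 ^ j" by linarith
        thus "k \<in> {..j}" by simp
      qed
      thus ?thesis by (rule finite_subset) simp
    qed
    let ?\<tau> = "\<lambda>\<rho>. random_time \<rho> n"
    let ?s = "\<lambda>k::nat. exp (- (2 ^ k * r))"
    let ?a = "\<lambda>k::nat. (2 * 2 ^ k) powr p * exp 1"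
    have pointwise: "(r * ?\<tau> \<rho>) powr (- p) \<le> 1 + (\<Sum>k\<in>A. ?a k * ?s k ^ ?\<tau> \<rho>)"
      if \<tau>: "0 < ?\<tau> \<rho>" for \<rho>
    proof (cases "1 \<le> r * ?\<tau> \<rho>")
      case True
      have "(r * ?\<tau> \<rho>) powr (- p) \<le> 1"
        using True p powr_mono2'[of "- p" 1 "r * ?\<tau> \<rho>"] by simp
      moreover have "0 \<le> (\<Sum>k\<in>A. ?a k * ?s k ^ ?\<tau> \<rho>)" by (intro sum_nonneg) auto
      ultimately show ?thesis by linarith
    next
      case False
      obtain k where k: "2 ^ k * (r * ?\<tau> \<rho>) \<le> 1"
        "(r * ?\<tau> \<rho>) powr (- p) \<le> (2 * 2 ^ k) powr p * (exp 1 * exp (- (2 ^ k * (r * ?\<tau> \<rho>))))"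
        using dyadic_powr_bound[of "r * ?\<tau> \<rho>" p] False r \<tau> p by auto
      have "2 ^ k * r * 1 \<le> 2 ^ k * r * ?\<tau> \<rho>"
        using r \<tau> by (intro mult_left_mono) auto
      also have "\<dots> \<le> 1" using k(1) by (simp only: mult.assoc)
      finally have "k \<in> A" by (simp add: A_def)
      hence "?a k * ?s k ^ ?\<tau> \<rho> \<le> (\<Sum>k\<in>A. ?a k * ?s k ^ ?\<tau> \<rho>)"
        using finA by (intro member_le_sum) auto
      moreover have "?a k * ?s k ^ ?\<tau> \<rho> = (2 * 2 ^ k) powr p * (exp 1 * exp (- (2 ^ k * (r * ?\<tau> \<rho>))))"
        by (simp add: mult_ac flip: exp_of_nat_mult)
      ultimately show ?thesis using k(2) by linarith
    qed
    have summand: "?a k * (1 - \<phi> (1 - ?s k)) ^ n \<le> exp 1 * (K * (1 / 2) ^ k)" if k: "k \<in> A" for k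
    proof -
      define u where "u = 2 ^ k * r"
      have u: "0 < u" "u \<le> 1" using k r by (auto simp: u_def A_def)
      have "r \<le> u" using r by (simp add: u_def)
      have "u / 2 \<le> 1 - exp (- u)"
        using min_le_one_minus_exp[of u] u by simp
      hence "\<phi> (u / 2) \<le> \<phi> (1 - exp (- u))" using u by (intro phi_mono) auto
      have "c / 2 * (2 ^ k) powr \<alpha> / n = c * (2 ^ k) powr \<alpha> / n / 2" by simp
      also have "\<dots> \<le> \<phi> u / 2"
        using le[of r u] r u \<open>r \<le> u\<close> by (simp add: u_def)
      also have "\<dots> \<le> \<phi> (u / 2)" using phi_scale[of "1/2" u] u by simp
      also have "\<dots> \<le> \<phi> (1 - exp (- u))" by fact
      finally have low: "c / 2 * (2 ^ k) powr \<alpha> / n \<le> \<phi> (1 - exp (- u))" .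
      have "0 \<le> 1 - \<phi> (1 - exp (- u))" using phi_le_one[of "1 - exp (- u)"] u by simp
      moreover have "1 - \<phi> (1 - exp (- u)) \<le> exp (- \<phi> (1 - exp (- u)))"
        using exp_ge_add_one_self[of "- \<phi> (1 - exp (- u))"] by linarith
      ultimately have "(1 - \<phi> (1 - exp (- u))) ^ n \<le> exp (- \<phi> (1 - exp (- u))) ^ n"
        by (intro power_mono)
      also have "\<dots> = exp (- (n * \<phi> (1 - exp (- u))))"
        by (simp only: exp_of_nat_mult[symmetric] mult_minus_right)
      also have "\<dots> \<le> exp (- (c / 2 * (2 ^ k) powr \<alpha>))"
        using mult_left_mono[OF low, of "real n"] n by simp
      finally have "?a k * (1 - \<phi> (1 - ?s k)) ^ n \<le> ?a k * exp (- (c / 2 * (2 ^ k) powr \<alpha>))"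
        by (intro mult_left_mono) (auto simp: u_def)
      also have "\<dots> = exp 1 * ((2 * 2 ^ k) powr p * exp (- (c / 2 * (2 ^ k) powr \<alpha>)))" by simp
      also have "\<dots> \<le> exp 1 * (K / 2 ^ k)" by (intro mult_left_mono K_bound) auto
      finally show ?thesis by (simp add: power_one_over)
    qed
    have geom: "(\<Sum>k\<in>A. (1 / 2) ^ k :: real) \<le> 2"
      using sum_le_suminf[of "\<lambda>k. (1 / 2) ^ k :: real" A] finA suminf_geometric[of "1 / 2 :: real"]
      by (simp add: summable_geometric)
    have split: "?\<tau> \<rho> powr (- p) = r powr p * (r * ?\<tau> \<rho>) powr (- p)" for \<rho>
      using r by (simp add: powr_mult powr_minus field_simps)
    have s: "0 \<le> ?s k" "?s k \<le> 1" for k using r by auto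
    have "(\<integral>\<^sup>+\<rho>. ennreal (?\<tau> \<rho> powr (- p)) \<partial>jumps) \<le>
      (\<integral>\<^sup>+\<rho>. ennreal (r powr p) * (1 + (\<Sum>k\<in>A. ennreal (?a k) * ennreal (?s k ^ ?\<tau> \<rho>))) \<partial>jumps)"
    proof (rule nn_integral_mono_AE, use random_time_positive[OF n] in eventually_elim)
      fix \<rho> assume "0 < ?\<tau> \<rho>"
      hence "ennreal (?\<tau> \<rho> powr (- p)) \<le> ennreal (r powr p * (1 + (\<Sum>k\<in>A. ?a k * ?s k ^ ?\<tau> \<rho>)))"
        unfolding split by (intro ennreal_leI mult_left_mono pointwise) auto
      also have "\<dots> = ennreal (r powr p) * (1 + (\<Sum>k\<in>A. ennreal (?a k) * ennreal (?s k ^ ?\<tau> \<rho>)))"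
        by (simp add: ennreal_mult ennreal_plus sum_nonneg flip: sum_ennreal)
      finally show "ennreal (?\<tau> \<rho> powr (- p)) \<le> \<dots>" .
    qed
    also have "\<dots> = ennreal (r powr p) * (1 + (\<Sum>k\<in>A. ennreal (?a k) * ennreal ((1 - \<phi> (1 - ?s k)) ^ n)))"
      by (simp add: nn_integral_cmult nn_integral_add nn_integral_sum emeasure_space_1
          time_generating_function[OF s])
    also have "\<dots> = ennreal (r powr p * (1 + (\<Sum>k\<in>A. ?a k * (1 - \<phi> (1 - ?s k)) ^ n)))"
    proof -
      have nn: "0 \<le> (1 - \<phi> (1 - ?s k)) ^ n" for k
        using phi_le_one[of "1 - ?s k"] s[of k] by simp
      show ?thesis
        by (simp add: ennreal_mult ennreal_plus sum_nonneg nn flip: sum_ennreal)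
    qed
    also have "\<dots> \<le> ennreal (r powr p * (1 + (\<Sum>k\<in>A. exp 1 * (K * (1 / 2) ^ k))))"
      by (intro ennreal_leI mult_left_mono add_left_mono sum_mono summand) auto
    also have "\<dots> \<le> ennreal (r powr p * C)"
      unfolding C_def sum_distrib_left[symmetric] using K geom
      by (intro ennreal_leI mult_left_mono add_left_mono) auto
    finally show "(\<integral>\<^sup>+\<rho>. ennreal (?\<tau> \<rho> powr (- p)) \<partial>jumps) \<le>
      ennreal (C * the_inv_into {0..} \<phi> (1 / real n) powr p)"
      by (simp add: r_def mult.commute)
  qed
qed

end

section \<open>The transition probabilities of the subordinate walk\<close>

theorem theorem6p17:
  fixes \<phi> :: "real \<Rightarrow> real" and \<mu> :: "real measure"
  assumes "complete_bernstein \<phi> \<mu>" and "\<phi> 0 = 0" and "\<phi> 1 = 1"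
    and "scaling_condition \<phi>"
  shows "\<exists>C::real. C > 0 \<and>
    (\<forall>(n::nat) (x :: int ^ 'd::finite) (y :: int ^ 'd). n \<ge> 1 \<longrightarrow>
       ereal (transition_prob \<mu> n x y) \<le>
         ereal C * min (ereal (the_inv_into {0..} \<phi> (1 / real n) powr (real CARD('d) / 2)))
                       (off_diagonal_bound \<phi> n x y))"
proof -
  interpret normalized_bernstein \<phi> \<mu> using assms by unfold_locales auto
  obtain D where D: "D > 0"
    and near: "\<And>m (z :: int ^ 'd). 0 < m \<Longrightarrow> lattice_walk m z \<le> D * real m powr (- (CARD('d) / 2))"
    and far: "\<And>m (z :: int ^ 'd). 0 < m \<Longrightarrow> z \<noteq> 0 \<Longrightarrow>
       lattice_walk m z \<le> D / lattice_norm z ^ CARD('d) * min 1 (m / (lattice_norm z)\<^sup>2)"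
    by (rule lattice_walk_local_bounds[where 'd='d]) (rule that; assumption)
  have p: "0 < real CARD('d) / 2" by simp
  obtain C where C: "C > 0" and moment: "\<And>n. 0 < n \<Longrightarrow>
    (\<integral>\<^sup>+\<rho>. ennreal (random_time \<rho> n powr (- (CARD('d) / 2))) \<partial>jumps) \<le>
      ennreal (C * the_inv_into {0..} \<phi> (1 / real n) powr (CARD('d) / 2))"
    by (rule time_negative_moment[OF assms(4,2) p]) (rule that; assumption)
  define B where "B = D * (C + 2)"
  have B: "D * C \<le> B" "D * 2 \<le> B" "B > 0" using C D by (auto simp: B_def)
  have diag: "transition_prob \<mu> n x y \<le> B * the_inv_into {0..} \<phi> (1 / real n) powr (CARD('d) / 2)"
    if n: "0 < n" for n and x y :: "int ^ 'd"
  proof -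
    have "ennreal (transition_prob \<mu> n x y) \<le>
      (\<integral>\<^sup>+\<rho>. ennreal D * ennreal (random_time \<rho> n powr (- (CARD('d) / 2))) \<partial>jumps)"
      unfolding transition_prob_mixture
    proof (rule nn_integral_mono_AE, use random_time_positive[OF n] in eventually_elim)
      fix \<rho> assume pos: "0 < random_time \<rho> n"
      have "ennreal (lattice_walk (random_time \<rho> n) (y - x)) \<le>
          ennreal (D * real (random_time \<rho> n) powr (- (CARD('d) / 2)))"
        by (intro ennreal_leI near pos)
      also have "\<dots> = ennreal D * ennreal (real (random_time \<rho> n) powr (- (CARD('d) / 2)))"
        using D by (intro ennreal_mult) auto
      finally show "ennreal (lattice_walk (random_time \<rho> n) (y - x)) \<le> \<dots>" .
    qed
    also have "\<dots> = ennreal D * (\<integral>\<^sup>+\<rho>. ennreal (random_time \<rho> n powr (- (CARD('d) / 2))) \<partial>jumps)"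
      by (rule nn_integral_cmult) measurable
    also have "\<dots> \<le> ennreal D * ennreal (C * the_inv_into {0..} \<phi> (1 / real n) powr (CARD('d) / 2))"
      by (intro mult_left_mono moment n) auto
    also have "\<dots> = ennreal (D * C * the_inv_into {0..} \<phi> (1 / real n) powr (CARD('d) / 2))"
      using C D by (simp only: mult.assoc) (intro ennreal_mult[symmetric], auto)
    finally have "transition_prob \<mu> n x y \<le> D * C * the_inv_into {0..} \<phi> (1 / real n) powr (CARD('d) / 2)"
      using C D by (subst (asm) ennreal_le_iff) auto
    also have "\<dots> \<le> B * the_inv_into {0..} \<phi> (1 / real n) powr (CARD('d) / 2)"
      using B by (intro mult_right_mono) auto
    finally show ?thesis .
  qed
  have off: "transition_prob \<mu> n x y \<le>
      B * (n / lattice_norm (x - y) ^ CARD('d) * \<phi> (lattice_norm (x - y) powi (-2)))"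
    if n: "0 < n" and xy: "x \<noteq> y" for n and x y :: "int ^ 'd"
  proof -
    define N where "N = lattice_norm (y - x)"
    have "(\<chi> i. real_of_int ((x - y) $ i)) = - (\<chi> i. real_of_int ((y - x) $ i))"
      by (simp add: vec_eq_iff)
    hence sym: "lattice_norm (x - y) = N"
      unfolding N_def lattice_norm_def by (simp only: norm_minus_cancel)
    have "(\<chi> i. real_of_int ((y - x) $ i)) \<noteq> 0" using xy by (simp add: vec_eq_iff) metis
    hence N: "N > 0" unfolding N_def lattice_norm_def by (rule zero_less_norm_iff[THEN iffD2])
    have "ennreal (transition_prob \<mu> n x y) \<le>
      (\<integral>\<^sup>+\<rho>. ennreal (D / N ^ CARD('d)) * ennreal (min 1 (random_time \<rho> n / N\<^sup>2)) \<partial>jumps)"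
      unfolding transition_prob_mixture
    proof (rule nn_integral_mono_AE, use random_time_positive[OF n] in eventually_elim)
      fix \<rho> assume pos: "0 < random_time \<rho> n"
      have "y - x \<noteq> 0" using xy by simp
      hence "ennreal (lattice_walk (random_time \<rho> n) (y - x)) \<le>
          ennreal (D / N ^ CARD('d) * min 1 (random_time \<rho> n / N\<^sup>2))"
        unfolding N_def by (intro ennreal_leI far pos)
      also have "\<dots> = ennreal (D / N ^ CARD('d)) * ennreal (min 1 (random_time \<rho> n / N\<^sup>2))"
        using D N by (intro ennreal_mult) auto
      finally show "ennreal (lattice_walk (random_time \<rho> n) (y - x)) \<le> \<dots>" .
    qed
    also have "\<dots> = ennreal (D / N ^ CARD('d)) * (\<integral>\<^sup>+\<rho>. ennreal (min 1 (random_time \<rho> n / N\<^sup>2)) \<partial>jumps)"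
      by (rule nn_integral_cmult) measurable
    also have "\<dots> \<le> ennreal (D / N ^ CARD('d)) * ennreal (2 * real n * \<phi> (1 / N\<^sup>2))"
      using N by (intro mult_left_mono time_truncated_mean) auto
    also have "\<dots> = ennreal (D * 2 * (n / N ^ CARD('d) * \<phi> (1 / N\<^sup>2)))"
    proof -
      have "ennreal (D / N ^ CARD('d)) * ennreal (2 * real n * \<phi> (1 / N\<^sup>2)) =
        ennreal (D / N ^ CARD('d) * (2 * real n * \<phi> (1 / N\<^sup>2)))"
        using D N phi_nonneg[of "1 / N\<^sup>2"] by (intro ennreal_mult[symmetric]) auto
      thus ?thesis by (simp only: times_divide_eq_left times_divide_eq_right mult_ac)
    qed
    finally have "transition_prob \<mu> n x y \<le> D * 2 * (n / N ^ CARD('d) * \<phi> (1 / N\<^sup>2))"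
      using D N phi_nonneg[of "1 / N\<^sup>2"] by (subst (asm) ennreal_le_iff) auto
    also have "\<dots> \<le> B * (n / N ^ CARD('d) * \<phi> (1 / N\<^sup>2))"
      using B N phi_nonneg[of "1 / N\<^sup>2"] by (intro mult_right_mono) auto
    also have "1 / N\<^sup>2 = N powi (-2)" by (simp add: power_int_minus inverse_eq_divide)
    finally show ?thesis by (simp add: sym)
  qed
  show ?thesis
  proof (intro exI[of _ B] conjI allI impI)
    fix n :: nat and x y :: "int ^ 'd" assume "1 \<le> n"
    hence n: "0 < n" by simp
    show "ereal (transition_prob \<mu> n x y) \<le>
      ereal B * min (ereal (the_inv_into {0..} \<phi> (1 / real n) powr (real CARD('d) / 2)))
                    (off_diagonal_bound \<phi> n x y)"
    proof (cases "x = y")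
      case True
      with diag[OF n, of x y] show ?thesis by (simp add: off_diagonal_bound_def)
    next
      case False
      have "transition_prob \<mu> n x y \<le>
        B * min (the_inv_into {0..} \<phi> (1 / real n) powr (real CARD('d) / 2))
          (n / lattice_norm (x - y) ^ CARD('d) * \<phi> (lattice_norm (x - y) powi (-2)))"
        unfolding min_mult_distrib_left using B diag[OF n, of x y] off[OF n False]
        by (simp only: less_imp_le if_True min.bounded_iff simp_thms)
      thus ?thesis using False by (simp only: off_diagonal_bound_def if_False ereal_min[symmetric]
          times_ereal.simps ereal_less_eq)
    qed
  qed (rule B)
qed

end
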